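(* Let $G$ be an amenable topological group and let $G\curvearrowright X$ be a continuous isometric action on a metric space $X$. Assume that the real vector space $\mathrm{Hom}(G,\mathbb{R})$ of continuous homomorphisms from $G$ to $\mathbb{R}$ is finite-dimensional. Then $\mathfrak{Lip}(X/\!\!/G)$ is isometrically isomorphic to a complemented subspace of $\mathfrak{Lip}(X)$.
   Context: A topological group $G$ is amenable if every continuous affine action of $G$ on a non-empty compact convex subset of a locally convex topological vector space has a fixed point. Equivalently, there is a mean $\mathfrak m$ (positive linear functional of norm $1$ with $\mathfrak m(\mathbf 1)=1$) on the algebra $\mathsf{LUCB}(G)$ of bounded functions $\phi:G\to\mathbb R$ for which $g\mapsto\phi(\,\cdot\,g)$ is continuous in the sup norm, such that $\mathfrak m(\phi(\,\cdot\, g))=\mathfrak m(\phi)$ for all $g\in G$. For a metric space $X$, $\mathsf{Lip}(X)$ is the vector space of all real-valued Lipschitz functions on $X$, and $\mathfrak{Lip}(X)=\mathsf{Lip}(X)/\{\text{constant functions}\}$, a Banach space under the norm $L(\phi)=\sup_{x\ne y}|\phi(x)-\phi(y)|/d(x,y)$. For an isometric action $G\curvearrowright X$, $X/\!\!/G=\{\overline{Gx}\mid x\in X\}$ is the set of closures of $G$-orbits, which is a metric space under the Hausdorff distance $d_H(\overline{Gx},\overline{Gy})=\max\{\sup_{z\in\overline{Gx}}\mathrm{dist}(z,\overline{Gy}),\sup_{z\in\overline{Gy}}\mathrm{dist}(z,\overline{Gx})\}$, which equals $\inf_{h\in G}d(hx,y)$. A closed subspace is complemented if it is the range of a bounded linear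 projection. *)

theory Defs
  imports "HOL-Analysis.Analysis" "HOL-Algebra.Group_Action"
begin

section \<open>Topological groups and amenability\<close>

text \<open>No separation axiom is imposed on the topology.\<close>

definition topological_group :: "('g, 'm) monoid_scheme \<Rightarrow> 'g topology \<Rightarrow> bool" where
  "topological_group G T \<longleftrightarrow>
     group G \<and> topspace T = carrier G \<and>
     continuous_map (prod_topology T T) T (\<lambda>(g, h). g \<otimes>\<^bsub>G\<^esub> h) \<and>
     continuous_map T T (\<lambda>g. inv\<^bsub>G\<^esub> g)"

text \<open>The bounded functions \<open>\<phi>\<close> on \<open>G\<close> for which \<open>g \<mapsto> \<phi>(\<cdot> g)\<close> is continuous in the sup norm;
  convergence in the sup norm over \<open>carrier G\<close> is \<open>uniform_limit (carrier G)\<close>.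
  Values of \<open>\<phi>\<close> outside \<open>carrier G\<close> are unconstrained.\<close>

definition LUCB :: "('g, 'm) monoid_scheme \<Rightarrow> 'g topology \<Rightarrow> ('g \<Rightarrow> real) set" where
  "LUCB G T = {\<phi>. bounded (\<phi> ` carrier G) \<and>
     (\<forall>g\<in>carrier G. uniform_limit (carrier G)
        (\<lambda>h x. \<phi> (x \<otimes>\<^bsub>G\<^esub> h)) (\<lambda>x. \<phi> (x \<otimes>\<^bsub>G\<^esub> g)) (atin T g))}"

text \<open>Together with \<open>m 1 = 1\<close>, the bound by the sup norm says that \<open>m\<close> has norm exactly 1.
  It also forces \<open>m \<phi>\<close> to depend only on the restriction of \<open>\<phi>\<close> to \<open>carrier G\<close>.\<close>

definition mean_on_LUCB :: "('g, 'm) monoid_scheme \<Rightarrow> 'g topology \<Rightarrow> (('g \<Rightarrow> real) \<Rightarrow> real) \<Rightarrow> bool" where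
  "mean_on_LUCB G T m \<longleftrightarrow>
     (\<forall>\<phi>\<in>LUCB G T. \<forall>\<psi>\<in>LUCB G T. m (\<lambda>x. \<phi> x + \<psi> x) = m \<phi> + m \<psi>) \<and>
     (\<forall>\<phi>\<in>LUCB G T. \<forall>c. m (\<lambda>x. c * \<phi> x) = c * m \<phi>) \<and>
     (\<forall>\<phi>\<in>LUCB G T. (\<forall>x\<in>carrier G. 0 \<le> \<phi> x) \<longrightarrow> 0 \<le> m \<phi>) \<and>
     (\<forall>\<phi>\<in>LUCB G T. \<bar>m \<phi>\<bar> \<le> (SUP x\<in>carrier G. \<bar>\<phi> x\<bar>)) \<and>
     m (\<lambda>x. 1) = 1"

text \<open>Amenability of a topological group in its invariant-mean form. The fixed-point form (every
  continuous affine action on a non-empty compact convex subset of a locally convex space has a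
  fixed point) quantifies over all locally convex spaces, hence over types, and so cannot be the
  body of a HOL definition.\<close>

definition amenable :: "('g, 'm) monoid_scheme \<Rightarrow> 'g topology \<Rightarrow> bool" where
  "amenable G T \<longleftrightarrow>
     (\<exists>m. mean_on_LUCB G T m \<and>
        (\<forall>g\<in>carrier G. \<forall>\<phi>\<in>LUCB G T. m (\<lambda>x. \<phi> (x \<otimes>\<^bsub>G\<^esub> g)) = m \<phi>))"

definition Hom_real :: "('g, 'm) monoid_scheme \<Rightarrow> 'g topology \<Rightarrow> ('g \<Rightarrow> real) set" where
  "Hom_real G T = {\<eta>. continuous_map T euclideanreal \<eta> \<and>
     (\<forall>g\<in>carrier G. \<forall>h\<in>carrier G. \<eta> (g \<otimes>\<^bsub>G\<^esub> h) = \<eta> g + \<eta> h)}"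

text \<open>Linear combinations are compared on \<open>carrier G\<close> only, where the homomorphisms live.\<close>

definition finite_dimensional_Hom_real :: "('g, 'm) monoid_scheme \<Rightarrow> 'g topology \<Rightarrow> bool" where
  "finite_dimensional_Hom_real G T \<longleftrightarrow>
     (\<exists>B. finite B \<and> B \<subseteq> Hom_real G T \<and>
        (\<forall>\<eta>\<in>Hom_real G T. \<exists>c. \<forall>g\<in>carrier G. \<eta> g = (\<Sum>b\<in>B. c b * b g)))"

section \<open>Isometric actions and the space of orbit closures\<close>

definition continuous_isometric_action ::
  "('g, 'm) monoid_scheme \<Rightarrow> 'g topology \<Rightarrow> 'x set \<Rightarrow> ('x \<Rightarrow> 'x \<Rightarrow> real) \<Rightarrow> ('g \<Rightarrow> 'x \<Rightarrow> 'x) \<Rightarrow> bool" where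
  "continuous_isometric_action G T X d \<alpha> \<longleftrightarrow>
     group_action G X \<alpha> \<and>
     (\<forall>g\<in>carrier G. \<forall>x\<in>X. \<forall>y\<in>X. d (\<alpha> g x) (\<alpha> g y) = d x y) \<and>
     continuous_map (prod_topology T (Metric_space.mtopology X d)) (Metric_space.mtopology X d)
       (\<lambda>(g, x). \<alpha> g x)"

definition orbit_closures ::
  "('g, 'm) monoid_scheme \<Rightarrow> 'x set \<Rightarrow> ('x \<Rightarrow> 'x \<Rightarrow> real) \<Rightarrow> ('g \<Rightarrow> 'x \<Rightarrow> 'x) \<Rightarrow> 'x set set" where
  "orbit_closures G X d \<alpha> = {Metric_space.mtopology X d closure_of orbit G \<alpha> x | x. x \<in> X}"

definition dist_to_set :: "('x \<Rightarrow> 'x \<Rightarrow> real) \<Rightarrow> 'x \<Rightarrow> 'x set \<Rightarrow> real" where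
  "dist_to_set d z A = (INF w\<in>A. d z w)"

definition hausdorff_dist :: "('x \<Rightarrow> 'x \<Rightarrow> real) \<Rightarrow> 'x set \<Rightarrow> 'x set \<Rightarrow> real" where
  "hausdorff_dist d A B = max (SUP z\<in>A. dist_to_set d z B) (SUP z\<in>B. dist_to_set d z A)"

section \<open>Real normed spaces with an explicit carrier\<close>

record 'v nvs =
  nv_carrier :: "'v set"
  nv_add :: "'v \<Rightarrow> 'v \<Rightarrow> 'v"
  nv_scale :: "real \<Rightarrow> 'v \<Rightarrow> 'v"
  nv_norm :: "'v \<Rightarrow> real"

definition nv_linear :: "'v nvs \<Rightarrow> 'w nvs \<Rightarrow> ('v \<Rightarrow> 'w) \<Rightarrow> bool" where
  "nv_linear V W f \<longleftrightarrow>
     f \<in> nv_carrier V \<rightarrow> nv_carrier W \<and>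
     (\<forall>u\<in>nv_carrier V. \<forall>v\<in>nv_carrier V. f (nv_add V u v) = nv_add W (f u) (f v)) \<and>
     (\<forall>c. \<forall>v\<in>nv_carrier V. f (nv_scale V c v) = nv_scale W c (f v))"

definition nv_bounded_linear :: "'v nvs \<Rightarrow> 'w nvs \<Rightarrow> ('v \<Rightarrow> 'w) \<Rightarrow> bool" where
  "nv_bounded_linear V W f \<longleftrightarrow>
     nv_linear V W f \<and> (\<exists>K. \<forall>v\<in>nv_carrier V. nv_norm W (f v) \<le> K * nv_norm V v)"

definition nv_closed_subspace :: "'v nvs \<Rightarrow> 'v set \<Rightarrow> bool" where
  "nv_closed_subspace V Y \<longleftrightarrow>
     Y \<subseteq> nv_carrier V \<and> Y \<noteq> {} \<and>
     (\<forall>u\<in>Y. \<forall>v\<in>Y. nv_add V u v \<in> Y) \<and>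
     (\<forall>c. \<forall>v\<in>Y. nv_scale V c v \<in> Y) \<and>
     (\<forall>s v. (\<forall>n::nat. s n \<in> Y) \<longrightarrow> v \<in> nv_carrier V \<longrightarrow>
        (\<lambda>n. nv_norm V (nv_add V (s n) (nv_scale V (-1) v))) \<longlonglongrightarrow> 0 \<longrightarrow> v \<in> Y)"

definition nv_complemented_subspace :: "'v nvs \<Rightarrow> 'v set \<Rightarrow> bool" where
  "nv_complemented_subspace V Y \<longleftrightarrow>
     nv_closed_subspace V Y \<and>
     (\<exists>P. nv_bounded_linear V V P \<and> (\<forall>v\<in>nv_carrier V. P (P v) = P v) \<and> P ` nv_carrier V = Y)"

definition nv_isometrically_isomorphic :: "'v nvs \<Rightarrow> 'w nvs \<Rightarrow> bool" where
  "nv_isometrically_isomorphic V W \<longleftrightarrow>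
     (\<exists>f. nv_linear V W f \<and> bij_betw f (nv_carrier V) (nv_carrier W) \<and>
        (\<forall>v\<in>nv_carrier V. nv_norm W (f v) = nv_norm V v))"

section \<open>Lipschitz functions modulo constants\<close>

definition Lip :: "'x set \<Rightarrow> ('x \<Rightarrow> 'x \<Rightarrow> real) \<Rightarrow> ('x \<Rightarrow> real) set" where
  "Lip X d = {\<phi>. \<exists>K. \<forall>x\<in>X. \<forall>y\<in>X. \<bar>\<phi> x - \<phi> y\<bar> \<le> K * d x y}"

text \<open>The inserted 0 gives the value 0 when \<open>X\<close> has at most one point.\<close>

definition lip_const :: "'x set \<Rightarrow> ('x \<Rightarrow> 'x \<Rightarrow> real) \<Rightarrow> ('x \<Rightarrow> real) \<Rightarrow> real" where
  "lip_const X d \<phi> = Sup (insert 0 {\<bar>\<phi> x - \<phi> y\<bar> / d x y | x y. x \<in> X \<and> y \<in> X \<and> x \<noteq> y})"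

text \<open>Elements of \<open>Lip X d\<close> are total functions of which only the values on \<open>X\<close> matter; the relation
  below therefore divides out both the constants and the values outside \<open>X\<close>.\<close>

definition lip_rel :: "'x set \<Rightarrow> ('x \<Rightarrow> 'x \<Rightarrow> real) \<Rightarrow> (('x \<Rightarrow> real) \<times> ('x \<Rightarrow> real)) set" where
  "lip_rel X d = {(\<phi>, \<psi>). \<phi> \<in> Lip X d \<and> \<psi> \<in> Lip X d \<and> (\<exists>c. \<forall>x\<in>X. \<phi> x - \<psi> x = c)}"

definition LIP :: "'x set \<Rightarrow> ('x \<Rightarrow> 'x \<Rightarrow> real) \<Rightarrow> ('x \<Rightarrow> real) set nvs" where
  "LIP X d =
     \<lparr>nv_carrier = Lip X d // lip_rel X d,
      nv_add = (\<lambda>A B. \<Union>\<phi>\<in>A. \<Union>\<psi>\<in>B. lip_rel X d `` {\<lambda>x. \<phi> x + \<psi> x}),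
      nv_scale = (\<lambda>c A. \<Union>\<phi>\<in>A. lip_rel X d `` {\<lambda>x. c * \<phi> x}),
      nv_norm = (\<lambda>A. the_elem (lip_const X d ` A))\<rparr>"

text \<open>The operations and the norm of \<open>LIP\<close> are well defined on equivalence classes.\<close>

lemma equiv_lip_rel: "equiv (Lip X d) (lip_rel X d)"
proof (rule equivI)
  show "lip_rel X d \<subseteq> Lip X d \<times> Lip X d" by (auto simp: lip_rel_def)
  show "refl_on (Lip X d) (lip_rel X d)" by (auto simp: refl_on_def lip_rel_def)
  show "sym (lip_rel X d)"
  proof (rule symI)
    fix f g assume "(f, g) \<in> lip_rel X d"
    then obtain c where "f \<in> Lip X d" "g \<in> Lip X d" "\<forall>x\<in>X. f x - g x = c"
      by (auto simp: lip_rel_def)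
    then show "(g, f) \<in> lip_rel X d"
      by (auto simp: lip_rel_def intro!: exI[of _ "- c"])
  qed
  show "trans (lip_rel X d)"
  proof (rule transI)
    fix f g h assume "(f, g) \<in> lip_rel X d" "(g, h) \<in> lip_rel X d"
    then obtain b c where "f \<in> Lip X d" "h \<in> Lip X d"
      "\<forall>x\<in>X. f x - g x = b" "\<forall>x\<in>X. g x - h x = c"
      by (auto simp: lip_rel_def)
    then show "(f, h) \<in> lip_rel X d"
      by (force simp: lip_rel_def intro!: exI[of _ "b + c"])
  qed
qed

lemma Lip_add:
  assumes "\<phi> \<in> Lip X d" "\<psi> \<in> Lip X d"
  shows "(\<lambda>x. \<phi> x + \<psi> x) \<in> Lip X d"
proof -
  obtain K L where "\<forall>x\<in>X. \<forall>y\<in>X. \<bar>\<phi> x - \<phi> y\<bar> \<le> K * d x y" "\<forall>x\<in>X. \<forall>y\<in>X. \<bar>\<psi> x - \<psi> y\<bar> \<le> L * d x y"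
    using assms by (auto simp: Lip_def)
  then have "\<forall>x\<in>X. \<forall>y\<in>X. \<bar>(\<phi> x + \<psi> x) - (\<phi> y + \<psi> y)\<bar> \<le> (K + L) * d x y"
    by (smt (verit) distrib_right)
  then show ?thesis by (auto simp: Lip_def)
qed

lemma Lip_scale:
  assumes "\<phi> \<in> Lip X d"
  shows "(\<lambda>x. c * \<phi> x) \<in> Lip X d"
proof -
  obtain K where K: "\<And>x y. x \<in> X \<Longrightarrow> y \<in> X \<Longrightarrow> \<bar>\<phi> x - \<phi> y\<bar> \<le> K * d x y"
    using assms by (auto simp: Lip_def)
  have "\<bar>c * \<phi> x - c * \<phi> y\<bar> \<le> (\<bar>c\<bar> * K) * d x y" if "x \<in> X" "y \<in> X" for x y
    using mult_left_mono[OF K[OF that] abs_ge_zero[of c]]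
    by (simp add: abs_mult[symmetric] right_diff_distrib mult.assoc)
  then show ?thesis by (auto simp: Lip_def)
qed

lemma LIP_add_class:
  assumes "\<phi> \<in> Lip X d" "\<psi> \<in> Lip X d"
  shows "nv_add (LIP X d) (lip_rel X d `` {\<phi>}) (lip_rel X d `` {\<psi>}) = lip_rel X d `` {\<lambda>x. \<phi> x + \<psi> x}"
proof -
  have "congruent2 (lip_rel X d) (lip_rel X d) (\<lambda>\<phi> \<psi>. lip_rel X d `` {\<lambda>x. \<phi> x + \<psi> x})"
  proof (rule congruent2I')
    fix f f' g g' assume *: "(f, f') \<in> lip_rel X d" "(g, g') \<in> lip_rel X d"
    then obtain b c where "\<forall>x\<in>X. f x - f' x = b" "\<forall>x\<in>X. g x - g' x = c"
      by (auto simp: lip_rel_def)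
    then have "\<forall>x\<in>X. (f x + g x) - (f' x + g' x) = b + c" by force
    then have "(\<lambda>x. f x + g x, \<lambda>x. f' x + g' x) \<in> lip_rel X d"
      using * unfolding lip_rel_def by (auto intro: Lip_add)
    then show "lip_rel X d `` {\<lambda>x. f x + g x} = lip_rel X d `` {\<lambda>x. f' x + g' x}"
      by (rule equiv_class_eq[OF equiv_lip_rel])
  qed
  then show ?thesis
    using UN_equiv_class2[OF equiv_lip_rel equiv_lip_rel _ assms] by (simp add: LIP_def)
qed

lemma LIP_scale_class:
  assumes "\<phi> \<in> Lip X d"
  shows "nv_scale (LIP X d) c (lip_rel X d `` {\<phi>}) = lip_rel X d `` {\<lambda>x. c * \<phi> x}"
proof -
  have "congruent (lip_rel X d) (\<lambda>\<phi>. lip_rel X d `` {\<lambda>x. c * \<phi> x})"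
  proof (rule congruentI)
    fix f g assume *: "(f, g) \<in> lip_rel X d"
    then obtain b where "\<forall>x\<in>X. f x - g x = b" by (auto simp: lip_rel_def)
    then have "\<forall>x\<in>X. c * f x - c * g x = c * b" by (simp add: right_diff_distrib[symmetric])
    then have "(\<lambda>x. c * f x, \<lambda>x. c * g x) \<in> lip_rel X d"
      using * unfolding lip_rel_def by (auto intro: Lip_scale)
    then show "lip_rel X d `` {\<lambda>x. c * f x} = lip_rel X d `` {\<lambda>x. c * g x}"
      by (rule equiv_class_eq[OF equiv_lip_rel])
  qed
  then show ?thesis
    using UN_equiv_class[OF equiv_lip_rel _ assms] by (simp add: LIP_def)
qed

lemma LIP_norm_class:
  assumes "\<phi> \<in> Lip X d"
  shows "nv_norm (LIP X d) (lip_rel X d `` {\<phi>}) = lip_const X d \<phi>"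
proof -
  have "lip_const X d \<psi> = lip_const X d \<phi>" if rel: "(\<phi>, \<psi>) \<in> lip_rel X d" for \<psi>
  proof -
    obtain c where c: "\<forall>x\<in>X. \<phi> x - \<psi> x = c" using rel by (auto simp: lip_rel_def)
    have key: "\<psi> x - \<psi> y = \<phi> x - \<phi> y" if "x \<in> X" "y \<in> X" for x y
      using c[rule_format, OF that(1)] c[rule_format, OF that(2)] by linarith
    have "{\<bar>\<psi> x - \<psi> y\<bar> / d x y | x y. x \<in> X \<and> y \<in> X \<and> x \<noteq> y} =
        {\<bar>\<phi> x - \<phi> y\<bar> / d x y | x y. x \<in> X \<and> y \<in> X \<and> x \<noteq> y}"
    proof (intro Collect_cong ex_cong1)
      fix v x y
      show "(v = \<bar>\<psi> x - \<psi> y\<bar> / d x y \<and> x \<in> X \<and> y \<in> X \<and> x \<noteq> y) =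
          (v = \<bar>\<phi> x - \<phi> y\<bar> / d x y \<and> x \<in> X \<and> y \<in> X \<and> x \<noteq> y)"
        by (cases "x \<in> X"; cases "y \<in> X") (simp_all only: key simp_thms)
    qed
    then show ?thesis by (simp add: lip_const_def)
  qed
  moreover have "\<phi> \<in> lip_rel X d `` {\<phi>}"
    using equiv_class_self[OF equiv_lip_rel assms] .
  ultimately have "lip_const X d ` (lip_rel X d `` {\<phi>}) = {lip_const X d \<phi>}" by blast
  then show ?thesis by (simp add: LIP_def)
qed

end

theory Submission
  imports Defs
begin

text \<open>Averaging \<open>g \<mapsto> \<phi> (g x) - \<phi> (g b)\<close> with the invariant mean projects the Lipschitz functions onto
  those whose class modulo constants is fixed by \<open>G\<close>. For such a \<open>\<phi>\<close> the number
  \<open>\<phi> (h x) - \<phi> x\<close> does not depend on \<open>x\<close> and is a continuous homomorphism in \<open>h\<close>. Since these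
  homomorphisms span a finite-dimensional space, they all vanish as soon as they vanish on a
  suitable finite set; hence the honestly invariant functions are cut out by finitely many bounded
  functionals and remain complemented. They are exactly the pullbacks of functions on the space of
  orbit closures, with the same Lipschitz constant because the Hausdorff distance is
  \<open>inf\<^sub>h d (h x) y\<close>.\<close>

section \<open>Operators between spaces of Lipschitz functions\<close>

text \<open>At distance 0, membership in \<open>Lip\<close> forces the numerator to vanish, so the
  quotient is 0 and both sides hold. Asking only for a nonnegative \<open>d\<close> lets this apply
  to the Hausdorff distance without first proving it a metric.\<close>

lemma lip_quotient_le_iff:
  fixes d :: "'x \<Rightarrow> 'x \<Rightarrow> real"
  assumes nonneg: "\<And>x y. x \<in> X \<Longrightarrow> y \<in> X \<Longrightarrow> 0 \<le> d x y"
    and \<phi>: "\<phi> \<in> Lip X d" and "x \<in> X" "y \<in> X" "0 \<le> C"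
  shows "\<bar>\<phi> x - \<phi> y\<bar> / d x y \<le> C \<longleftrightarrow> \<bar>\<phi> x - \<phi> y\<bar> \<le> C * d x y"
proof -
  obtain L where "\<bar>\<phi> x - \<phi> y\<bar> \<le> L * d x y"
    using assms unfolding Lip_def by blast
  then show ?thesis
    using nonneg[OF assms(3,4)] \<open>0 \<le> C\<close> by (cases "d x y = 0") (auto simp: divide_le_eq)
qed

lemma lip_quotients_bdd_above:
  fixes d :: "'x \<Rightarrow> 'x \<Rightarrow> real"
  assumes nonneg: "\<And>x y. x \<in> X \<Longrightarrow> y \<in> X \<Longrightarrow> 0 \<le> d x y" and \<phi>: "\<phi> \<in> Lip X d"
  shows "bdd_above (insert 0 {\<bar>\<phi> x - \<phi> y\<bar> / d x y | x y. x \<in> X \<and> y \<in> X \<and> x \<noteq> y})"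
proof -
  obtain L where L: "\<And>x y. x \<in> X \<Longrightarrow> y \<in> X \<Longrightarrow> \<bar>\<phi> x - \<phi> y\<bar> \<le> L * d x y"
    using \<phi> by (auto simp: Lip_def)
  \<comment> \<open>\<open>Lip\<close> does not ask for a nonnegative constant, hence the maximum
    with 0.\<close>
  have "\<bar>\<phi> x - \<phi> y\<bar> / d x y \<le> max 0 L" if "x \<in> X" "y \<in> X" for x y
    using L[OF that] mult_right_mono[OF max.cobounded2[of L 0] nonneg[OF that]]
    by (subst lip_quotient_le_iff[OF nonneg \<phi> that]) auto
  then show ?thesis
    by (intro bdd_aboveI[of _ "max 0 L"]) auto
qed

lemma lip_const_nonneg:
  assumes "\<And>x y. x \<in> X \<Longrightarrow> y \<in> X \<Longrightarrow> 0 \<le> d x y" "\<phi> \<in> Lip X d"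
  shows "0 \<le> lip_const X d \<phi>"
  unfolding lip_const_def by (rule cSup_upper) (auto simp: lip_quotients_bdd_above[OF assms, simplified])

text \<open>This characterises \<open>lip_const\<close> as the least nonnegative Lipschitz constant,
  so that estimates need not return to the supremum. The pairs with \<open>x = y\<close>, absent
  from the quotients, satisfy the bound trivially.\<close>

lemma lip_const_le_iff:
  assumes nonneg: "\<And>x y. x \<in> X \<Longrightarrow> y \<in> X \<Longrightarrow> 0 \<le> d x y"
    and \<phi>: "\<phi> \<in> Lip X d" and "0 \<le> K"
  shows "lip_const X d \<phi> \<le> K \<longleftrightarrow> (\<forall>x\<in>X. \<forall>y\<in>X. \<bar>\<phi> x - \<phi> y\<bar> \<le> K * d x y)"
proof -
  let ?Q = "{\<bar>\<phi> x - \<phi> y\<bar> / d x y | x y. x \<in> X \<and> y \<in> X \<and> x \<noteq> y}"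
  have "lip_const X d \<phi> \<le> K \<longleftrightarrow> (\<forall>q\<in>insert 0 ?Q. q \<le> K)"
    unfolding lip_const_def by (intro cSup_le_iff lip_quotients_bdd_above nonneg \<phi>) auto
  also have "\<dots> \<longleftrightarrow> (\<forall>x\<in>X. \<forall>y\<in>X. x \<noteq> y \<longrightarrow> \<bar>\<phi> x - \<phi> y\<bar> / d x y \<le> K)"
    using \<open>0 \<le> K\<close> by blast
  also have "\<dots> \<longleftrightarrow> (\<forall>x\<in>X. \<forall>y\<in>X. x \<noteq> y \<longrightarrow> \<bar>\<phi> x - \<phi> y\<bar> \<le> K * d x y)"
    using lip_quotient_le_iff[OF nonneg \<phi> _ _ \<open>0 \<le> K\<close>] by blast
  also have "\<dots> \<longleftrightarrow> (\<forall>x\<in>X. \<forall>y\<in>X. \<bar>\<phi> x - \<phi> y\<bar> \<le> K * d x y)"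
    using nonneg \<open>0 \<le> K\<close> by (metis abs_zero diff_self mult_nonneg_nonneg)
  finally show ?thesis .
qed

lemma lip_const_bound:
  assumes "\<And>x y. x \<in> X \<Longrightarrow> y \<in> X \<Longrightarrow> 0 \<le> d x y" "\<phi> \<in> Lip X d" "x \<in> X" "y \<in> X"
  shows "\<bar>\<phi> x - \<phi> y\<bar> \<le> lip_const X d \<phi> * d x y"
  using lip_const_le_iff[OF assms(1,2) lip_const_nonneg[OF assms(1,2)]] assms(3,4) by blast

lemma LipI: "(\<And>x y. x \<in> X \<Longrightarrow> y \<in> X \<Longrightarrow> \<bar>\<phi> x - \<phi> y\<bar> \<le> K * d x y) \<Longrightarrow> \<phi> \<in> Lip X d"
  by (auto simp: Lip_def)

lemma lip_relI:
  assumes "\<phi> \<in> Lip X d" "\<psi> \<in> Lip X d" "\<And>x. x \<in> X \<Longrightarrow> \<phi> x = \<psi> x + c"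
  shows "(\<phi>, \<psi>) \<in> lip_rel X d"
  using assms by (auto simp: lip_rel_def)

lemma lip_relD:
  assumes "(\<phi>, \<psi>) \<in> lip_rel X d" "x \<in> X" "y \<in> X"
  shows "\<phi> x - \<phi> y = \<psi> x - \<psi> y"
proof -
  obtain c where "\<forall>x\<in>X. \<phi> x - \<psi> x = c" using assms(1) by (auto simp: lip_rel_def)
  then have "\<phi> x - \<psi> x = c" "\<phi> y - \<psi> y = c" using assms by auto
  then show ?thesis by linarith
qed

abbreviation lip_class :: "'x set \<Rightarrow> ('x \<Rightarrow> 'x \<Rightarrow> real) \<Rightarrow> ('x \<Rightarrow> real) \<Rightarrow> ('x \<Rightarrow> real) set" where
  "lip_class X d \<phi> \<equiv> lip_rel X d `` {\<phi>}"

lemma LIP_carrier: "nv_carrier (LIP X d) = lip_class X d ` Lip X d"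
  by (auto simp: LIP_def quotient_def)

lemma lip_class_eq_iff:
  "\<phi> \<in> Lip X d \<Longrightarrow> \<psi> \<in> Lip X d \<Longrightarrow> lip_class X d \<phi> = lip_class X d \<psi> \<longleftrightarrow> (\<phi>, \<psi>) \<in> lip_rel X d"
  by (rule eq_equiv_class_iff[OF equiv_lip_rel])

section \<open>Bounded operators and their descent to classes modulo constants\<close>

text \<open>Bounded linear maps for the seminorms \<open>lip_const\<close>, on representatives
  instead of classes. Linearity is asked only at points of \<open>X\<close>, where values matter.
  The bound makes every \<open>S f\<close> Lipschitz and every image of a constant function constant
  on \<open>X\<close>.\<close>

definition lip_operator ::
  "'y set \<Rightarrow> ('y \<Rightarrow> 'y \<Rightarrow> real) \<Rightarrow> 'x set \<Rightarrow> ('x \<Rightarrow> 'x \<Rightarrow> real) \<Rightarrow> (('y \<Rightarrow> real) \<Rightarrow> 'x \<Rightarrow> real) \<Rightarrow> bool"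
  where "lip_operator Y e X d S \<longleftrightarrow>
    (\<forall>f\<in>Lip Y e. \<forall>g\<in>Lip Y e. \<forall>x\<in>X. S (\<lambda>y. f y + g y) x = S f x + S g x) \<and>
    (\<forall>f\<in>Lip Y e. \<forall>c. \<forall>x\<in>X. S (\<lambda>y. c * f y) x = c * S f x) \<and>
    (\<exists>K\<ge>0. \<forall>f\<in>Lip Y e. \<forall>x\<in>X. \<forall>y\<in>X. \<bar>S f x - S f y\<bar> \<le> K * lip_const Y e f * d x y)"

lemma lip_operator_Lip:
  assumes "lip_operator Y e X d S" "f \<in> Lip Y e"
  shows "S f \<in> Lip X d"
  using assms unfolding lip_operator_def by (blast intro: LipI)

text \<open>Two representatives of one class differ on \<open>Y\<close> by a constant, so their
  difference has Lipschitz constant 0. The bound on \<open>S\<close> then makes the image of the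
  difference constant on \<open>X\<close>, and the class of \<open>S f\<close> depends only on the
  class of \<open>f\<close>.\<close>

lemma lip_operator_lift:
  assumes S: "lip_operator Y e X d S"
    and e: "\<And>x y. x \<in> Y \<Longrightarrow> y \<in> Y \<Longrightarrow> 0 \<le> e x y"
    and d: "\<And>x y. x \<in> X \<Longrightarrow> y \<in> X \<Longrightarrow> 0 \<le> d x y"
  obtains F where "nv_bounded_linear (LIP Y e) (LIP X d) F"
    "\<And>f. f \<in> Lip Y e \<Longrightarrow> F (lip_class Y e f) = lip_class X d (S f)"
proof -
  define F where "F A = (\<Union>f\<in>A. lip_class X d (S f))" for A
  obtain K where "K \<ge> 0"
    and K: "\<And>f x y. f \<in> Lip Y e \<Longrightarrow> x \<in> X \<Longrightarrow> y \<in> X \<Longrightarrow> \<bar>S f x - S f y\<bar> \<le> K * lip_const Y e f * d x y"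
    and add: "\<And>f g x. f \<in> Lip Y e \<Longrightarrow> g \<in> Lip Y e \<Longrightarrow> x \<in> X \<Longrightarrow> S (\<lambda>y. f y + g y) x = S f x + S g x"
    and scale: "\<And>f c x. f \<in> Lip Y e \<Longrightarrow> x \<in> X \<Longrightarrow> S (\<lambda>y. c * f y) x = c * S f x"
    using S unfolding lip_operator_def by blast
  note Lip_S = lip_operator_Lip[OF S]
  have cong: "lip_class X d (S f) = lip_class X d (S g)" if fg: "(f, g) \<in> lip_rel Y e" for f g
  proof -
    have f: "f \<in> Lip Y e" and g: "g \<in> Lip Y e" using fg by (auto simp: lip_rel_def)
    let ?u = "\<lambda>y. f y + (-1) * g y"
    have u: "?u \<in> Lip Y e" by (intro Lip_add Lip_scale f g)
    have "lip_const Y e ?u \<le> 0"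
      using lip_relD[OF fg] by (subst lip_const_le_iff[OF e u]) (force simp: algebra_simps)+
    then have u0: "lip_const Y e ?u = 0" using lip_const_nonneg[OF e u] by simp
    have Su: "S ?u x = S f x - S g x" if "x \<in> X" for x
      using add[OF f Lip_scale[OF g, of "-1"] that] scale[OF g that, of "-1"] by simp
    have "S f x - S g x = S f y - S g y" if "x \<in> X" "y \<in> X" for x y
      using K[OF u that] unfolding u0 Su[OF that(1)] Su[OF that(2)] by simp
    then have "\<exists>c. \<forall>x\<in>X. S f x - S g x = c" by metis
    then have "(S f, S g) \<in> lip_rel X d"
      using Lip_S f g by (auto simp: lip_rel_def)
    then show ?thesis by (rule equiv_class_eq[OF equiv_lip_rel])
  qed
  have F: "F (lip_class Y e f) = lip_class X d (S f)" if "f \<in> Lip Y e" for f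
    unfolding F_def
    by (rule UN_equiv_class[OF equiv_lip_rel _ that]) (auto intro!: congruentI cong)
  have eq: "lip_class X d f = lip_class X d g"
    if "f \<in> Lip X d" "g \<in> Lip X d" "\<And>x. x \<in> X \<Longrightarrow> f x = g x" for f g
    using that by (auto simp: lip_class_eq_iff intro!: lip_relI[where c = 0])
  have "lip_class X d (S (\<lambda>y. f y + g y)) = lip_class X d (\<lambda>x. S f x + S g x)"
    if "f \<in> Lip Y e" "g \<in> Lip Y e" for f g
    using that by (intro eq add Lip_S Lip_add)
  moreover have "lip_class X d (S (\<lambda>y. c * f y)) = lip_class X d (\<lambda>x. c * S f x)"
    if "f \<in> Lip Y e" for f c
    using that by (intro eq scale Lip_S Lip_scale)
  ultimately have "nv_linear (LIP Y e) (LIP X d) F"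
    unfolding nv_linear_def
    by (auto simp: LIP_carrier LIP_add_class LIP_scale_class F Lip_S Lip_add Lip_scale)
  moreover have "nv_norm (LIP X d) (F v) \<le> K * nv_norm (LIP Y e) v"
    if v: "v \<in> nv_carrier (LIP Y e)" for v
  proof -
    obtain f where f: "f \<in> Lip Y e" "v = lip_class Y e f"
      using v unfolding LIP_carrier by blast
    have "lip_const X d (S f) \<le> K * lip_const Y e f"
      using K[OF f(1)] \<open>K \<ge> 0\<close> lip_const_nonneg[OF e f(1)]
      by (subst lip_const_le_iff[OF d Lip_S[OF f(1)]]) auto
    then show ?thesis by (simp add: f F Lip_S LIP_norm_class)
  qed
  ultimately have "nv_bounded_linear (LIP Y e) (LIP X d) F"
    unfolding nv_bounded_linear_def by blast
  then show ?thesis using F that by blast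
qed

section \<open>Projections onto common kernels of finitely many functionals\<close>

text \<open>Passing to the kernel of a single functional \<open>\<phi> \<mapsto> \<phi> a - \<phi> b\<close> keeps a subspace complemented:
  if \<open>v\<close> has value 1 there, replace \<open>P \<phi>\<close> by \<open>P \<phi> - (P \<phi> a - P \<phi> b) v\<close>.\<close>

lemma lip_projection_kernel:
  assumes P: "lip_operator X d X d P" and PZ: "\<And>\<phi>. \<phi> \<in> Lip X d \<Longrightarrow> P \<phi> \<in> Z"
    and Pfix: "\<And>\<phi>. \<phi> \<in> Z \<Longrightarrow> (\<phi>, P \<phi>) \<in> lip_rel X d"
    and ZLip: "Z \<subseteq> Lip X d"
    and Zlin: "\<And>\<phi> \<psi> c. \<phi> \<in> Z \<Longrightarrow> \<psi> \<in> Z \<Longrightarrow> (\<lambda>x. \<phi> x + c * \<psi> x) \<in> Z"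
    and a: "a \<in> X" and b: "b \<in> X"
    and d: "\<And>x y. x \<in> X \<Longrightarrow> y \<in> X \<Longrightarrow> 0 \<le> d x y"
  shows "\<exists>P'. lip_operator X d X d P' \<and> (\<forall>\<phi>\<in>Lip X d. P' \<phi> \<in> {\<phi> \<in> Z. \<phi> a = \<phi> b}) \<and>
    (\<forall>\<phi>\<in>{\<phi> \<in> Z. \<phi> a = \<phi> b}. (\<phi>, P' \<phi>) \<in> lip_rel X d)"
proof (cases "\<forall>\<phi>\<in>Z. \<phi> a = \<phi> b")
  case True
  then show ?thesis using P PZ Pfix by (intro exI[of _ P]) auto
next
  case False
  then obtain w where w: "w \<in> Z" "w a \<noteq> w b" by blast
  \<comment> \<open>This is \<open>w\<close> divided by \<open>w a - w b\<close>, written in the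
    shape \<open>\<phi> + c * \<psi>\<close> under which \<open>Z\<close> is closed.\<close>
  define v where "v x = w x + (1 / (w a - w b) - 1) * w x" for x
  have vZ: "v \<in> Z" unfolding v_def using Zlin[OF w(1) w(1)] .
  have v_eq: "v x = w x / (w a - w b)" for x by (simp add: v_def algebra_simps)
  have vab: "v a - v b = 1" using w(2) by (simp add: v_eq diff_divide_distrib[symmetric])
  obtain K where "K \<ge> 0"
    and K: "\<And>f x y. f \<in> Lip X d \<Longrightarrow> x \<in> X \<Longrightarrow> y \<in> X \<Longrightarrow> \<bar>P f x - P f y\<bar> \<le> K * lip_const X d f * d x y"
    and add: "\<And>f g x. f \<in> Lip X d \<Longrightarrow> g \<in> Lip X d \<Longrightarrow> x \<in> X \<Longrightarrow> P (\<lambda>y. f y + g y) x = P f x + P g x"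
    and scale: "\<And>f c x. f \<in> Lip X d \<Longrightarrow> x \<in> X \<Longrightarrow> P (\<lambda>y. c * f y) x = c * P f x"
    using P unfolding lip_operator_def by blast
  define P' where "P' \<phi> = (\<lambda>x. P \<phi> x + (- (P \<phi> a - P \<phi> b)) * v x)" for \<phi>
  have vLip: "v \<in> Lip X d" using vZ ZLip by blast
  define V where "V = lip_const X d v"
  have V0: "0 \<le> V" using lip_const_nonneg[OF d vLip] by (simp add: V_def)
  have V: "\<bar>v x - v y\<bar> \<le> V * d x y" if "x \<in> X" "y \<in> X" for x y
    using lip_const_bound[OF d vLip that] by (simp add: V_def)
  \<comment> \<open>The first \<open>K\<close> bounds \<open>P\<close>. The correction contributes
    \<open>K * d a b\<close> from the coefficient \<open>P \<phi> a - P \<phi> b\<close>, times the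
    Lipschitz constant \<open>V\<close> of \<open>v\<close>.\<close>
  have "\<bar>P' \<phi> x - P' \<phi> y\<bar> \<le> (K + K * d a b * V) * lip_const X d \<phi> * d x y"
    if \<phi>: "\<phi> \<in> Lip X d" and xy: "x \<in> X" "y \<in> X" for \<phi> x y
  proof -
    have "P' \<phi> x - P' \<phi> y = (P \<phi> x - P \<phi> y) - (P \<phi> a - P \<phi> b) * (v x - v y)"
      by (simp add: P'_def algebra_simps)
    then have "\<bar>P' \<phi> x - P' \<phi> y\<bar> \<le> \<bar>P \<phi> x - P \<phi> y\<bar> + \<bar>P \<phi> a - P \<phi> b\<bar> * \<bar>v x - v y\<bar>"
      by (metis abs_mult abs_triangle_ineq4)
    also have "\<dots> \<le> K * lip_const X d \<phi> * d x y + (K * lip_const X d \<phi> * d a b) * (V * d x y)"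
      using K[OF \<phi> xy] K[OF \<phi> a b] V[OF xy]
      by (intro add_mono mult_mono) (auto intro: order_trans[OF abs_ge_zero])
    finally show ?thesis by (simp add: algebra_simps)
  qed
  moreover have "K + K * d a b * V \<ge> 0" using \<open>K \<ge> 0\<close> V0 d[OF a b] by simp
  ultimately have "\<exists>K\<ge>0. \<forall>\<phi>\<in>Lip X d. \<forall>x\<in>X. \<forall>y\<in>X.
      \<bar>P' \<phi> x - P' \<phi> y\<bar> \<le> K * lip_const X d \<phi> * d x y" by blast
  moreover have "P' (\<lambda>y. f y + g y) x = P' f x + P' g x"
    if "f \<in> Lip X d" "g \<in> Lip X d" "x \<in> X" for f g x
    using that a b by (simp add: P'_def add) (simp add: algebra_simps)
  moreover have "P' (\<lambda>y. c * f y) x = c * P' f x" if "f \<in> Lip X d" "x \<in> X" for f c x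
    using that a b by (simp add: P'_def scale) (simp add: algebra_simps)
  ultimately have "lip_operator X d X d P'"
    unfolding lip_operator_def by blast
  moreover have "P' \<phi> \<in> {\<phi> \<in> Z. \<phi> a = \<phi> b}" if "\<phi> \<in> Lip X d" for \<phi>
  proof -
    have "P' \<phi> \<in> Z" unfolding P'_def by (intro Zlin PZ vZ that)
    moreover have "P' \<phi> a - P' \<phi> b = (P \<phi> a - P \<phi> b) - (P \<phi> a - P \<phi> b) * (v a - v b)"
      by (simp add: P'_def algebra_simps)
    ultimately show ?thesis using vab by simp
  qed
  moreover have "(\<phi>, P' \<phi>) \<in> lip_rel X d" if "\<phi> \<in> Z" "\<phi> a = \<phi> b" for \<phi>
  proof -
    have "P \<phi> a - P \<phi> b = 0" using lip_relD[OF Pfix[OF that(1)] a b] that(2) by simp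
    then show ?thesis using Pfix[OF that(1)] by (simp add: P'_def)
  qed
  ultimately show ?thesis by blast
qed

text \<open>The functionals are imposed one at a time: each step applies the case of a single
  functional to the subspace already cut out by the previous ones.\<close>

lemma lip_projection_kernels:
  assumes "lip_operator X d X d P" "\<And>\<phi>. \<phi> \<in> Lip X d \<Longrightarrow> P \<phi> \<in> Z"
    and "\<And>\<phi>. \<phi> \<in> Z \<Longrightarrow> (\<phi>, P \<phi>) \<in> lip_rel X d"
    and ZLip: "Z \<subseteq> Lip X d"
    and Zlin: "\<And>\<phi> \<psi> c. \<phi> \<in> Z \<Longrightarrow> \<psi> \<in> Z \<Longrightarrow> (\<lambda>x. \<phi> x + c * \<psi> x) \<in> Z"
    and b: "b \<in> X"
    and d: "\<And>x y. x \<in> X \<Longrightarrow> y \<in> X \<Longrightarrow> 0 \<le> d x y"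
    and "finite A" "A \<subseteq> X"
  shows "\<exists>P'. lip_operator X d X d P' \<and> (\<forall>\<phi>\<in>Lip X d. P' \<phi> \<in> {\<phi> \<in> Z. \<forall>a\<in>A. \<phi> a = \<phi> b}) \<and>
    (\<forall>\<phi>\<in>{\<phi> \<in> Z. \<forall>a\<in>A. \<phi> a = \<phi> b}. (\<phi>, P' \<phi>) \<in> lip_rel X d)"
  using \<open>finite A\<close> \<open>A \<subseteq> X\<close>
proof (induction A rule: finite_induct)
  case empty
  then show ?case using assms(1-3) by (intro exI[of _ P]) auto
next
  case (insert a A)
  let ?Z = "{\<phi> \<in> Z. \<forall>a\<in>A. \<phi> a = \<phi> b}"
  obtain Q where Q: "lip_operator X d X d Q" "\<forall>\<phi>\<in>Lip X d. Q \<phi> \<in> ?Z"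
    "\<forall>\<phi>\<in>?Z. (\<phi>, Q \<phi>) \<in> lip_rel X d"
    using insert by blast
  have eq: "{\<phi> \<in> Z. \<forall>a'\<in>insert a A. \<phi> a' = \<phi> b} = {\<phi> \<in> ?Z. \<phi> a = \<phi> b}" by auto
  show ?case
    unfolding eq
  proof (rule lip_projection_kernel[OF Q(1)])
    show "(\<lambda>x. \<phi> x + c * \<psi> x) \<in> ?Z" if "\<phi> \<in> ?Z" "\<psi> \<in> ?Z" for \<phi> \<psi> c
      using that Zlin by auto
  qed (use Q insert.prems b ZLip d in auto)
qed

section \<open>Finitely many evaluations separate a finite-dimensional function space\<close>

text \<open>By induction on \<open>B\<close>, at most one new point is needed for each new function
  \<open>b0\<close>. Either some combination with coefficient 1 at \<open>b0\<close> vanishes on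
  \<open>F\<close> but not at some \<open>g\<close> in \<open>S\<close>, and then \<open>g\<close>
  is added, or \<open>F\<close> still suffices.\<close>

lemma finite_determining_set:
  fixes B :: "('a \<Rightarrow> real) set"
  assumes "finite B"
  shows "\<exists>F. finite F \<and> F \<subseteq> S \<and>
    (\<forall>c. (\<forall>g\<in>F. (\<Sum>b\<in>B. c b * b g) = 0) \<longrightarrow> (\<forall>g\<in>S. (\<Sum>b\<in>B. c b * b g) = 0))"
  using assms
proof (induction B rule: finite_induct)
  case empty
  then show ?case by auto
next
  case (insert b0 B)
  let ?s = "\<lambda>c g. \<Sum>b\<in>B. c b * b g"
  obtain F where F: "finite F" "F \<subseteq> S" "\<And>c. \<forall>g\<in>F. ?s c g = 0 \<Longrightarrow> \<forall>g\<in>S. ?s c g = 0"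
    using insert.IH by blast
  have sum_insert: "(\<Sum>b\<in>insert b0 B. c b * b g) = c b0 * b0 g + ?s c g" for c g
    using insert.hyps by simp
  show ?case
  proof (cases "\<exists>c g. g \<in> S \<and> b0 g + ?s c g \<noteq> 0 \<and> (\<forall>h\<in>F. b0 h + ?s c h = 0)")
    case True
    then obtain c g where c: "g \<in> S" "b0 g + ?s c g \<noteq> 0" "\<And>h. h \<in> F \<Longrightarrow> b0 h + ?s c h = 0"
      by blast
    have "\<forall>h\<in>S. c' b0 * b0 h + ?s c' h = 0"
      if c': "\<forall>h\<in>insert g F. c' b0 * b0 h + ?s c' h = 0" for c'
    proof -
      define k where "k = c' b0"
      \<comment> \<open>Subtracting \<open>k\<close> times the combination given by \<open>c\<close>
        cancels \<open>b0\<close>. The remainder is a combination of \<open>B\<close> that vanishes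
        on \<open>F\<close>, hence on \<open>S\<close>; evaluating at \<open>g\<close> then forces
        \<open>k = 0\<close>.\<close>
      have diff: "?s (\<lambda>b. c' b - k * c b) h = k * b0 h + ?s c' h - k * (b0 h + ?s c h)" for h
        by (simp add: left_diff_distrib sum_subtractf sum_distrib_left algebra_simps)
      have c'k: "k * b0 h + ?s c' h = 0" if "h \<in> insert g F" for h
        using c' that unfolding k_def by blast
      have "?s (\<lambda>b. c' b - k * c b) h = 0" if "h \<in> F" for h
        unfolding diff c(3)[OF that] using c'k[of h] that by simp
      then have *: "k * b0 h + ?s c' h = k * (b0 h + ?s c h)" if "h \<in> S" for h
        using F(3)[of "\<lambda>b. c' b - k * c b"] that unfolding diff by simp
      have "k = 0" using *[OF c(1)] c'k[of g] c(2) by simp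
      then show ?thesis using * unfolding k_def by simp
    qed
    then show ?thesis
      unfolding sum_insert using F(1,2) c(1) by (intro exI[of _ "insert g F"] conjI) blast+
  next
    case False
    then have vanish: "b0 g + ?s c g = 0" if "\<And>h. h \<in> F \<Longrightarrow> b0 h + ?s c h = 0" "g \<in> S" for c g
      using that by blast
    have "\<forall>h\<in>S. c b0 * b0 h + ?s c h = 0" if c: "\<forall>h\<in>F. c b0 * b0 h + ?s c h = 0" for c
    proof (cases "c b0 = 0")
      case True
      have "?s c h = 0" if "h \<in> F" for h
        using bspec[OF c that] True by (simp only: mult_zero_left add_0_left)
      then have "\<forall>h\<in>S. ?s c h = 0" using F(3)[of c] by blast
      then show ?thesis using True by (simp only: mult_zero_left add_0_left)
    next
      case nz: False
      \<comment> \<open>Dividing by \<open>c b0\<close> normalises the coefficient of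
        \<open>b0\<close> to 1, the only case covered by \<open>vanish\<close>.\<close>
      have eq: "b0 h + ?s (\<lambda>b. c b / c b0) h = (c b0 * b0 h + ?s c h) / c b0" for h
      proof -
        have "?s (\<lambda>b. c b / c b0) h = ?s c h / c b0"
          unfolding sum_divide_distrib by (intro sum.cong refl) (rule times_divide_eq_left)
        then show ?thesis using nz by (simp add: add_divide_distrib)
      qed
      have *: "b0 h + ?s (\<lambda>b. c b / c b0) h = 0" if "h \<in> F" for h
        unfolding eq using c that by simp
      have **: "b0 h + ?s (\<lambda>b. c b / c b0) h = 0" if "h \<in> S" for h
        by (rule vanish) (rule *, assumption, rule that)
      show ?thesis
      proof
        fix h assume "h \<in> S"
        from **[OF this] show "c b0 * b0 h + ?s c h = 0" unfolding eq using nz by simp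
      qed
    qed
    then show ?thesis
      unfolding sum_insert using F(1,2) by (intro exI[of _ F] conjI) blast+
  qed
qed

section \<open>Isometric actions\<close>

locale isometric_action = Metric_space X d for X :: "'x set" and d +
  fixes G :: "('g, 'm) monoid_scheme" (structure) and T :: "'g topology" and \<alpha> :: "'g \<Rightarrow> 'x \<Rightarrow> 'x"
  assumes topological_group: "topological_group G T"
    and action: "continuous_isometric_action G T X d \<alpha>"
begin

sublocale group G
  using topological_group by (simp add: topological_group_def)

sublocale group_action G X \<alpha>
  using action by (simp add: continuous_isometric_action_def)

lemma topspace_T: "topspace T = carrier G"
  using topological_group by (simp add: topological_group_def)

lemma isometry: "g \<in> carrier G \<Longrightarrow> x \<in> X \<Longrightarrow> y \<in> X \<Longrightarrow> d (\<alpha> g x) (\<alpha> g y) = d x y"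
  using action by (simp add: continuous_isometric_action_def)

lemma act_closed [simp]: "g \<in> carrier G \<Longrightarrow> x \<in> X \<Longrightarrow> \<alpha> g x \<in> X"
  using element_image by blast

lemma act_mult: "g \<in> carrier G \<Longrightarrow> h \<in> carrier G \<Longrightarrow> x \<in> X \<Longrightarrow> \<alpha> (g \<otimes> h) x = \<alpha> g (\<alpha> h x)"
  using composition_rule by blast

lemma act_one [simp]: "x \<in> X \<Longrightarrow> \<alpha> \<one> x = x"
  using id_eq_one by (metis restrict_apply')

lemma act_inv [simp]: "g \<in> carrier G \<Longrightarrow> x \<in> X \<Longrightarrow> \<alpha> (inv g) (\<alpha> g x) = x"
  by (metis act_mult act_one inv_closed l_inv)

lemma act_inv' [simp]: "g \<in> carrier G \<Longrightarrow> x \<in> X \<Longrightarrow> \<alpha> g (\<alpha> (inv g) x) = x"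
  by (metis act_mult act_one inv_closed r_inv)

text \<open>Joint continuity of the action, composed with \<open>h \<mapsto> (h, x)\<close>, makes
  the orbit map of \<open>x\<close> continuous.\<close>

lemma orbit_map_neighbourhood:
  assumes "x \<in> X" "g \<in> carrier G" "\<epsilon> > 0"
  obtains U where "openin T U" "g \<in> U" "U \<subseteq> carrier G" "\<And>h. h \<in> U \<Longrightarrow> d (\<alpha> h x) (\<alpha> g x) < \<epsilon>"
proof -
  have "continuous_map T (prod_topology T mtopology) (\<lambda>h. (h, x))"
    using assms by (intro continuous_map_pairedI) auto
  from continuous_map_compose[OF this] action
  have "continuous_map T mtopology (\<lambda>h. \<alpha> h x)"
    by (fastforce simp: continuous_isometric_action_def o_def)
  then obtain U where "openin T U" "g \<in> U" "\<forall>h\<in>U. \<alpha> h x \<in> mball (\<alpha> g x) \<epsilon>"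
    using assms topspace_T unfolding continuous_map_to_metric by metis
  then show ?thesis
    using that[of U] topspace_T openin_subset[of T U] by (auto simp: commute)
qed

lemma Lip_bound: "\<phi> \<in> Lip X d \<Longrightarrow> x \<in> X \<Longrightarrow> y \<in> X \<Longrightarrow> \<bar>\<phi> x - \<phi> y\<bar> \<le> lip_const X d \<phi> * d x y"
  by (rule lip_const_bound) auto

lemma Lip_small:
  assumes "\<phi> \<in> Lip X d" "\<epsilon> > 0"
  obtains \<delta> where "\<delta> > 0" "\<And>x y. x \<in> X \<Longrightarrow> y \<in> X \<Longrightarrow> d x y < \<delta> \<Longrightarrow> \<bar>\<phi> x - \<phi> y\<bar> < \<epsilon>"
proof -
  define L where "L = lip_const X d \<phi>"
  have L: "0 \<le> L" unfolding L_def by (rule lip_const_nonneg) (use assms in auto)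
  show ?thesis
  proof
    \<comment> \<open>Using \<open>L + 1\<close> instead of \<open>L\<close> keeps the denominator
      positive when \<open>\<phi>\<close> is constant.\<close>
    show "\<epsilon> / (L + 1) > 0" using L assms by simp
    show "\<bar>\<phi> x - \<phi> y\<bar> < \<epsilon>" if "x \<in> X" "y \<in> X" "d x y < \<epsilon> / (L + 1)" for x y
    proof -
      have "\<bar>\<phi> x - \<phi> y\<bar> \<le> (L + 1) * d x y"
        using Lip_bound[OF assms(1) that(1,2)] mult_right_mono[of L "L + 1" "d x y"] by (simp add: L_def)
      also have "\<dots> < \<epsilon>" using that(3) L by (simp add: pos_less_divide_eq mult.commute)
      finally show ?thesis .
    qed
  qed
qed

text \<open>A single function \<open>g \<mapsto> \<phi> (\<alpha> g x)\<close> may be unbounded; the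
  difference is bounded because \<open>g\<close> preserves the distance of \<open>x\<close> and
  \<open>y\<close>. Continuity is uniform in the left factor \<open>k\<close> because the points
  \<open>k h x\<close> and \<open>k g x\<close> are as far apart as \<open>h x\<close> and
  \<open>g x\<close>.\<close>

lemma orbit_difference_LUCB:
  assumes \<phi>: "\<phi> \<in> Lip X d" and x: "x \<in> X" and y: "y \<in> X"
  shows "(\<lambda>g. \<phi> (\<alpha> g x) - \<phi> (\<alpha> g y)) \<in> LUCB G T"
proof -
  have "\<bar>\<phi> (\<alpha> g x) - \<phi> (\<alpha> g y)\<bar> \<le> lip_const X d \<phi> * d x y" if "g \<in> carrier G" for g
    using Lip_bound[OF \<phi>, of "\<alpha> g x" "\<alpha> g y"] isometry[OF that x y] that x y by simp
  then have "bounded ((\<lambda>g. \<phi> (\<alpha> g x) - \<phi> (\<alpha> g y)) ` carrier G)"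
    by (auto simp: bounded_iff)
  moreover have "uniform_limit (carrier G)
      (\<lambda>h k. \<phi> (\<alpha> (k \<otimes> h) x) - \<phi> (\<alpha> (k \<otimes> h) y)) (\<lambda>k. \<phi> (\<alpha> (k \<otimes> g) x) - \<phi> (\<alpha> (k \<otimes> g) y)) (atin T g)"
    if g: "g \<in> carrier G" for g
  proof (rule uniform_limitI)
    fix e :: real assume "e > 0"
    then obtain \<delta> where \<delta>: "\<delta> > 0" "\<And>x y. x \<in> X \<Longrightarrow> y \<in> X \<Longrightarrow> d x y < \<delta> \<Longrightarrow> \<bar>\<phi> x - \<phi> y\<bar> < e / 2"
      using Lip_small[OF \<phi>, of "e / 2"] by auto
    obtain U where U: "openin T U" "g \<in> U" "U \<subseteq> carrier G" "\<And>h. h \<in> U \<Longrightarrow> d (\<alpha> h x) (\<alpha> g x) < \<delta>"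
      using orbit_map_neighbourhood[OF x g \<delta>(1)] by blast
    obtain V where V: "openin T V" "g \<in> V" "V \<subseteq> carrier G" "\<And>h. h \<in> V \<Longrightarrow> d (\<alpha> h y) (\<alpha> g y) < \<delta>"
      using orbit_map_neighbourhood[OF y g \<delta>(1)] by blast
    have "dist (\<phi> (\<alpha> (k \<otimes> h) x) - \<phi> (\<alpha> (k \<otimes> h) y)) (\<phi> (\<alpha> (k \<otimes> g) x) - \<phi> (\<alpha> (k \<otimes> g) y)) < e"
      if h: "h \<in> U" "h \<in> V" and k: "k \<in> carrier G" for h k
    proof -
      have hG: "h \<in> carrier G" using h U(3) by blast
      have "\<bar>\<phi> (\<alpha> k (\<alpha> h x)) - \<phi> (\<alpha> k (\<alpha> g x))\<bar> < e / 2" "\<bar>\<phi> (\<alpha> k (\<alpha> h y)) - \<phi> (\<alpha> k (\<alpha> g y))\<bar> < e / 2"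
        using U(4)[OF h(1)] V(4)[OF h(2)] hG g k x y by (simp_all only: \<delta>(2) isometry act_closed)
      then show ?thesis using hG g k x y by (simp add: act_mult dist_real_def del: less_divide_eq_numeral1)
    qed
    then show "\<forall>\<^sub>F h in atin T g. \<forall>k\<in>carrier G.
        dist (\<phi> (\<alpha> (k \<otimes> h) x) - \<phi> (\<alpha> (k \<otimes> h) y)) (\<phi> (\<alpha> (k \<otimes> g) x) - \<phi> (\<alpha> (k \<otimes> g) y)) < e"
      unfolding eventually_atin using U(1,2) V(1,2)
      by (intro disjI2 exI[of _ "U \<inter> V"]) (auto intro: openin_Int)
  qed
  ultimately show ?thesis by (simp add: LUCB_def)
qed

text \<open>The representatives of the elements of \<open>LIP X d\<close> that are fixed by \<open>G\<close>.\<close>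

definition quasi_invariant :: "('x \<Rightarrow> real) set" where
  "quasi_invariant = {\<phi> \<in> Lip X d. \<forall>h\<in>carrier G. \<forall>x\<in>X. \<forall>y\<in>X. \<phi> (\<alpha> h x) - \<phi> (\<alpha> h y) = \<phi> x - \<phi> y}"

definition invariant :: "('x \<Rightarrow> real) set" where
  "invariant = {\<phi> \<in> Lip X d. \<forall>h\<in>carrier G. \<forall>x\<in>X. \<phi> (\<alpha> h x) = \<phi> x}"

lemma LUCB_cong:
  assumes "\<phi> \<in> LUCB G T" "\<And>g. g \<in> carrier G \<Longrightarrow> \<psi> g = \<phi> g"
  shows "\<psi> \<in> LUCB G T"
proof -
  have "uniform_limit (carrier G) (\<lambda>h x. \<psi> (x \<otimes> h)) (\<lambda>x. \<psi> (x \<otimes> g)) (atin T g)"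
    if g: "g \<in> carrier G" for g
  proof -
    have "uniform_limit (carrier G) (\<lambda>h x. \<phi> (x \<otimes> h)) (\<lambda>x. \<phi> (x \<otimes> g)) (atin T g)"
      using assms(1) g by (simp add: LUCB_def)
    moreover have "\<forall>\<^sub>F h in atin T g. \<forall>x\<in>carrier G. \<psi> (x \<otimes> h) = \<phi> (x \<otimes> h)"
      unfolding eventually_atin using assms(2) g topspace_T
      by (intro disjI2 exI[of _ "carrier G"]) (metis DiffD1 m_closed openin_topspace)
    ultimately show ?thesis
      using assms(2) g by (auto elim!: uniform_limit_cong[THEN iffD2, rotated -1])
  qed
  moreover have "\<psi> ` carrier G = \<phi> ` carrier G" using assms(2) by (rule image_cong[OF refl])
  ultimately show ?thesis using assms(1) by (simp add: LUCB_def)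
qed

text \<open>The mean is defined on total functions, so it must be checked that it ignores values
  outside \<open>carrier G\<close>. The difference of \<open>f\<close> and \<open>g\<close> has
  supremum norm 0 there, and the norm bound makes its mean 0.\<close>

lemma mean_cong:
  assumes m: "mean_on_LUCB G T m" and f: "f \<in> LUCB G T" and g: "g \<in> LUCB G T"
    and eq: "\<And>x. x \<in> carrier G \<Longrightarrow> f x = g x"
  shows "m f = m g"
proof -
  let ?w = "\<lambda>x. f x + (-1) * g x"
  have scale: "\<And>f c. f \<in> LUCB G T \<Longrightarrow> m (\<lambda>x. c * f x) = c * m f"
    and add: "\<And>f g. f \<in> LUCB G T \<Longrightarrow> g \<in> LUCB G T \<Longrightarrow> m (\<lambda>x. f x + g x) = m f + m g"
    and sup: "\<And>f. f \<in> LUCB G T \<Longrightarrow> \<bar>m f\<bar> \<le> (SUP x\<in>carrier G. \<bar>f x\<bar>)"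
    using m unfolding mean_on_LUCB_def by blast+
  have "(\<lambda>x. -1 * g x) \<in> LUCB G T"
    using g by (auto simp: LUCB_def bounded_iff intro!: uniform_limit_uminus)
  have w: "?w \<in> LUCB G T"
    by (rule LUCB_cong[of "\<lambda>x. 0"]) (auto simp: LUCB_def eq uniform_limit_const bounded_iff)
  have "(SUP x\<in>carrier G. \<bar>?w x\<bar>) \<le> 0"
    by (rule cSUP_least) (auto simp: eq)
  then have "m ?w = 0" using sup[OF w] by linarith
  then show ?thesis using add[OF f \<open>(\<lambda>x. -1 * g x) \<in> LUCB G T\<close>] scale[OF g, of "-1"] by simp
qed

lemma quasi_invariantD:
  assumes "\<phi> \<in> quasi_invariant"
  shows "\<phi> \<in> Lip X d"
    and "h \<in> carrier G \<Longrightarrow> x \<in> X \<Longrightarrow> y \<in> X \<Longrightarrow> \<phi> (\<alpha> h x) - \<phi> (\<alpha> h y) = \<phi> x - \<phi> y"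
  using assms unfolding quasi_invariant_def by blast+

text \<open>Quasi-invariance under \<open>g\<close> at the points \<open>h x\<close> and
  \<open>x\<close> reads \<open>\<phi> (g h x) - \<phi> (g x) = \<phi> (h x) - \<phi> x\<close>,
  which is additivity. Continuity comes from the orbit map and the uniform continuity of
  \<open>\<phi>\<close>.\<close>

lemma quasi_invariant_translation_Hom:
  assumes \<phi>: "\<phi> \<in> quasi_invariant" and x: "x \<in> X"
  shows "(\<lambda>h. \<phi> (\<alpha> h x) - \<phi> x) \<in> Hom_real G T"
proof -
  note Lip = quasi_invariantD(1)[OF \<phi>] and q = quasi_invariantD(2)[OF \<phi>]
  have "continuous_map T euclideanreal (\<lambda>h. \<phi> (\<alpha> h x) - \<phi> x)"
    unfolding mtopology_is_euclidean[symmetric] Met_TC.continuous_map_to_metric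
  proof (intro ballI allI impI)
    fix g and e :: real assume g: "g \<in> topspace T" and "e > 0"
    obtain \<delta> where \<delta>: "\<delta> > 0" "\<And>x y. x \<in> X \<Longrightarrow> y \<in> X \<Longrightarrow> d x y < \<delta> \<Longrightarrow> \<bar>\<phi> x - \<phi> y\<bar> < e"
      using Lip_small[OF Lip \<open>e > 0\<close>] by blast
    obtain U where U: "openin T U" "g \<in> U" "U \<subseteq> carrier G" "\<And>h. h \<in> U \<Longrightarrow> d (\<alpha> h x) (\<alpha> g x) < \<delta>"
      using orbit_map_neighbourhood[OF x _ \<delta>(1)] g topspace_T by blast
    have "\<bar>\<phi> (\<alpha> h x) - \<phi> (\<alpha> g x)\<bar> < e" if "h \<in> U" for h
      using \<delta>(2)[OF _ _ U(4)[OF that]] that U(3) x g topspace_T by auto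
    then show "\<exists>U. openin T U \<and> g \<in> U \<and>
        (\<forall>h\<in>U. \<phi> (\<alpha> h x) - \<phi> x \<in> Met_TC.mball (\<phi> (\<alpha> g x) - \<phi> x) e)"
      using U(1,2) by (intro exI[of _ U]) (auto simp: dist_real_def abs_minus_commute)
  qed
  moreover have "\<phi> (\<alpha> (g \<otimes> h) x) - \<phi> x = (\<phi> (\<alpha> g x) - \<phi> x) + (\<phi> (\<alpha> h x) - \<phi> x)"
    if "g \<in> carrier G" "h \<in> carrier G" for g h
    using q[of g "\<alpha> h x" x] that x by (simp add: act_mult)
  ultimately show ?thesis by (simp add: Hom_real_def)
qed

section \<open>Averaging and the projection onto invariant functions\<close>

lemma averaging_operator:
  assumes "amenable G T" and b: "b \<in> X"
  obtains P where "lip_operator X d X d P"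
    "\<And>\<phi>. \<phi> \<in> Lip X d \<Longrightarrow> P \<phi> \<in> quasi_invariant"
    "\<And>\<phi>. \<phi> \<in> quasi_invariant \<Longrightarrow> (\<phi>, P \<phi>) \<in> lip_rel X d"
proof -
  obtain m where m: "mean_on_LUCB G T m"
    and inv: "\<And>g \<phi>. g \<in> carrier G \<Longrightarrow> \<phi> \<in> LUCB G T \<Longrightarrow> m (\<lambda>x. \<phi> (x \<otimes> g)) = m \<phi>"
    using assms(1) unfolding amenable_def by blast
  have add: "\<And>f g. f \<in> LUCB G T \<Longrightarrow> g \<in> LUCB G T \<Longrightarrow> m (\<lambda>x. f x + g x) = m f + m g"
    and scale: "\<And>f c. f \<in> LUCB G T \<Longrightarrow> m (\<lambda>x. c * f x) = c * m f"
    and sup: "\<And>f. f \<in> LUCB G T \<Longrightarrow> \<bar>m f\<bar> \<le> (SUP x\<in>carrier G. \<bar>f x\<bar>)"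
    and one: "m (\<lambda>x. 1) = 1"
    using m unfolding mean_on_LUCB_def by blast+
  have bound: "\<bar>m f\<bar> \<le> C" if "f \<in> LUCB G T" "\<And>g. g \<in> carrier G \<Longrightarrow> \<bar>f g\<bar> \<le> C" for f C
  proof -
    have "(SUP g\<in>carrier G. \<bar>f g\<bar>) \<le> C" by (rule cSUP_least) (use that in auto)
    then show ?thesis using sup[OF that(1)] by linarith
  qed
  have one_LUCB: "(\<lambda>x. 1) \<in> LUCB G T"
    by (auto simp: LUCB_def uniform_limit_const bounded_iff)
  define \<Delta> where "\<Delta> \<phi> x y = (\<lambda>g. \<phi> (\<alpha> g x) - \<phi> (\<alpha> g y))" for \<phi> :: "'x \<Rightarrow> real" and x y
  have \<Delta>: "\<Delta> \<phi> x y \<in> LUCB G T" if "\<phi> \<in> Lip X d" "x \<in> X" "y \<in> X" for \<phi> x y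
    unfolding \<Delta>_def using orbit_difference_LUCB[OF that] .
  \<comment> \<open>Subtracting the value at the base point \<open>b\<close> makes the averaged
    function bounded. By \<open>P_diff\<close> another base point would change
    \<open>P \<phi>\<close> only by a constant on \<open>X\<close>.\<close>
  define P where "P \<phi> x = m (\<Delta> \<phi> x b)" for \<phi> x
  have P_diff: "P \<phi> x - P \<phi> y = m (\<Delta> \<phi> x y)" if "\<phi> \<in> Lip X d" "x \<in> X" "y \<in> X" for \<phi> x y
  proof -
    have "\<Delta> \<phi> x b = (\<lambda>g. \<Delta> \<phi> x y g + \<Delta> \<phi> y b g)" by (auto simp: \<Delta>_def)
    then show ?thesis using add[OF \<Delta> \<Delta>] that b by (simp add: P_def)
  qed
  have P_add: "P (\<lambda>y. f y + g y) x = P f x + P g x" if "f \<in> Lip X d" "g \<in> Lip X d" "x \<in> X" for f g x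
  proof -
    have "\<Delta> (\<lambda>y. f y + g y) x b = (\<lambda>k. \<Delta> f x b k + \<Delta> g x b k)" by (auto simp: \<Delta>_def)
    then show ?thesis using add[OF \<Delta> \<Delta>] that b by (simp add: P_def)
  qed
  have P_scale: "P (\<lambda>y. c * f y) x = c * P f x" if "f \<in> Lip X d" "x \<in> X" for f c x
  proof -
    have "\<Delta> (\<lambda>y. c * f y) x b = (\<lambda>k. c * \<Delta> f x b k)" by (auto simp: \<Delta>_def algebra_simps)
    then show ?thesis using scale[OF \<Delta>] that b by (simp add: P_def)
  qed
  have P_bound: "\<bar>P \<phi> x - P \<phi> y\<bar> \<le> lip_const X d \<phi> * d x y"
    if "\<phi> \<in> Lip X d" "x \<in> X" "y \<in> X" for \<phi> x y
  proof -
    have "\<bar>\<Delta> \<phi> x y g\<bar> \<le> lip_const X d \<phi> * d x y" if "g \<in> carrier G" for g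
      using Lip_bound[OF \<open>\<phi> \<in> Lip X d\<close>, of "\<alpha> g x" "\<alpha> g y"] isometry that \<open>x \<in> X\<close> \<open>y \<in> X\<close>
      by (simp add: \<Delta>_def)
    then show ?thesis using bound[OF \<Delta>[OF that]] by (simp add: P_diff that)
  qed
  \<comment> \<open>The constant is 1: averaging does not increase Lipschitz constants.\<close>
  have P: "lip_operator X d X d P"
    unfolding lip_operator_def using P_add P_scale P_bound
    by (intro conjI ballI allI exI[of _ 1]) auto
  have "P \<phi> \<in> quasi_invariant" if \<phi>: "\<phi> \<in> Lip X d" for \<phi>
  proof -
    have "P \<phi> (\<alpha> h x) - P \<phi> (\<alpha> h y) = P \<phi> x - P \<phi> y"
      if h: "h \<in> carrier G" and x: "x \<in> X" and y: "y \<in> X" for h x y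
    proof -
      \<comment> \<open>Moving both points by \<open>h\<close> is right translation of
        \<open>\<Delta> \<phi> x y\<close> by \<open>h\<close>, which the mean does not see. The two
        functions agree only on \<open>carrier G\<close>, hence the use of
        \<open>mean_cong\<close>.\<close>
      let ?u = "\<lambda>k. \<Delta> \<phi> x y (k \<otimes> h)"
      let ?w = "\<Delta> \<phi> (\<alpha> h x) (\<alpha> h y)"
      have w: "?w \<in> LUCB G T" by (intro \<Delta> \<phi> act_closed h x y)
      have eq: "?u k = ?w k" if "k \<in> carrier G" for k
        using that h x y by (simp add: \<Delta>_def act_mult)
      have u: "?u \<in> LUCB G T"
        using LUCB_cong[OF w, of ?u] eq by simp
      have "m ?u = m ?w" by (rule mean_cong[OF m u w eq])
      then show ?thesis using inv[OF h \<Delta>[OF \<phi> x y]] by (simp add: P_diff \<phi> h x y)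
    qed
    then show ?thesis using lip_operator_Lip[OF P \<phi>] by (simp add: quasi_invariant_def)
  qed
  moreover have "(\<phi>, P \<phi>) \<in> lip_rel X d" if \<phi>: "\<phi> \<in> quasi_invariant" for \<phi>
  proof -
    note Lip = quasi_invariantD(1)[OF \<phi>]
    have "P \<phi> x = \<phi> x - \<phi> b" if x: "x \<in> X" for x
    proof -
      \<comment> \<open>For quasi-invariant \<open>\<phi>\<close> the averaged function is constant
        in \<open>g\<close>; the factor 1 exhibits it as a multiple of the function of mean
        1.\<close>
      have "\<Delta> \<phi> x b g = (\<phi> x - \<phi> b) * 1" if "g \<in> carrier G" for g
        using quasi_invariantD(2)[OF \<phi> that x b] by (simp add: \<Delta>_def)
      then have "m (\<Delta> \<phi> x b) = m (\<lambda>g. (\<phi> x - \<phi> b) * 1)"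
        using LUCB_cong[OF \<Delta>[OF Lip x b]] by (intro mean_cong[OF m \<Delta>[OF Lip x b]]) auto
      then show ?thesis using scale[OF one_LUCB, of "\<phi> x - \<phi> b"] one by (simp add: P_def)
    qed
    then show ?thesis
      by (intro lip_relI[where c = "\<phi> b"] Lip lip_operator_Lip[OF P Lip]) simp
  qed
  ultimately show ?thesis using P that by blast
qed

lemma invariant_projection:
  assumes "amenable G T" "finite_dimensional_Hom_real G T"
  obtains P where "lip_operator X d X d P"
    "\<And>\<phi>. \<phi> \<in> Lip X d \<Longrightarrow> P \<phi> \<in> invariant"
    "\<And>\<phi>. \<phi> \<in> invariant \<Longrightarrow> (\<phi>, P \<phi>) \<in> lip_rel X d"
proof (cases "X = {}")
  case True
  \<comment> \<open>Without points there is no base point to average against, but then every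
    function is invariant and all functions are equivalent.\<close>
  then show ?thesis
    by (intro that[of id]) (auto simp: lip_operator_def invariant_def[unfolded True] lip_rel_def Lip_def)
next
  case False
  then obtain b where b: "b \<in> X" by blast
  obtain P where P: "lip_operator X d X d P"
    "\<And>\<phi>. \<phi> \<in> Lip X d \<Longrightarrow> P \<phi> \<in> quasi_invariant"
    "\<And>\<phi>. \<phi> \<in> quasi_invariant \<Longrightarrow> (\<phi>, P \<phi>) \<in> lip_rel X d"
    using averaging_operator[OF assms(1) b] by blast
  obtain B where B: "finite B"
    "\<And>\<eta>. \<eta> \<in> Hom_real G T \<Longrightarrow> \<exists>c. \<forall>g\<in>carrier G. \<eta> g = (\<Sum>b\<in>B. c b * b g)"
    using assms(2) unfolding finite_dimensional_Hom_real_def by blast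
  obtain F where F: "finite F" "F \<subseteq> carrier G"
    "\<And>c. \<forall>g\<in>F. (\<Sum>b\<in>B. c b * b g) = 0 \<Longrightarrow> \<forall>g\<in>carrier G. (\<Sum>b\<in>B. c b * b g) = 0"
    using finite_determining_set[OF B(1), of "carrier G"] by blast
  have Hom_zero: "\<eta> g = 0" if \<eta>: "\<eta> \<in> Hom_real G T" "\<forall>g\<in>F. \<eta> g = 0" "g \<in> carrier G" for \<eta> g
  proof -
    obtain c where c: "\<forall>g\<in>carrier G. \<eta> g = (\<Sum>b\<in>B. c b * b g)" using B(2)[OF \<eta>(1)] by blast
    then have "\<forall>g\<in>F. (\<Sum>b\<in>B. c b * b g) = 0" using \<eta>(2) F(2) by (metis subsetD)
    then show ?thesis using F(3) c \<eta>(3) by metis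
  qed
  \<comment> \<open>Equality of \<open>\<phi>\<close> at \<open>\<alpha> g b\<close> and at
    \<open>b\<close> for all \<open>g\<close> in \<open>F\<close> says that the homomorphism
    \<open>h \<mapsto> \<phi> (\<alpha> h b) - \<phi> b\<close> vanishes on \<open>F\<close>, hence
    on all of \<open>carrier G\<close>.\<close>
  let ?A = "(\<lambda>g. \<alpha> g b) ` F"
  have "\<exists>P'. lip_operator X d X d P' \<and>
      (\<forall>\<phi>\<in>Lip X d. P' \<phi> \<in> {\<phi> \<in> quasi_invariant. \<forall>a\<in>?A. \<phi> a = \<phi> b}) \<and>
      (\<forall>\<phi>\<in>{\<phi> \<in> quasi_invariant. \<forall>a\<in>?A. \<phi> a = \<phi> b}. (\<phi>, P' \<phi>) \<in> lip_rel X d)"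
  proof (rule lip_projection_kernels[OF P])
    show "(\<lambda>x. \<phi> x + c * \<psi> x) \<in> quasi_invariant"
      if "\<phi> \<in> quasi_invariant" "\<psi> \<in> quasi_invariant" for \<phi> \<psi> c
    proof -
      have "(\<phi> (\<alpha> h x) + c * \<psi> (\<alpha> h x)) - (\<phi> (\<alpha> h y) + c * \<psi> (\<alpha> h y)) = (\<phi> x + c * \<psi> x) - (\<phi> y + c * \<psi> y)"
        if "h \<in> carrier G" "x \<in> X" "y \<in> X" for h x y
      proof -
        have "\<phi> (\<alpha> h x) - \<phi> (\<alpha> h y) = \<phi> x - \<phi> y" "\<psi> (\<alpha> h x) - \<psi> (\<alpha> h y) = \<psi> x - \<psi> y"
          by (intro quasi_invariantD(2) that \<open>\<phi> \<in> quasi_invariant\<close> \<open>\<psi> \<in> quasi_invariant\<close>)+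
        then show ?thesis by algebra
      qed
      moreover have "(\<lambda>x. \<phi> x + c * \<psi> x) \<in> Lip X d"
        by (intro Lip_add Lip_scale quasi_invariantD(1) that)
      ultimately show ?thesis unfolding quasi_invariant_def by blast
    qed
  qed (use b F(1,2) in \<open>auto dest: quasi_invariantD(1)\<close>)
  moreover have "{\<phi> \<in> quasi_invariant. \<forall>a\<in>?A. \<phi> a = \<phi> b} = invariant"
  proof (intro equalityI subsetI)
    fix \<phi> assume \<phi>: "\<phi> \<in> {\<phi> \<in> quasi_invariant. \<forall>a\<in>?A. \<phi> a = \<phi> b}"
    have "\<phi> (\<alpha> h b) - \<phi> b = 0" if "h \<in> carrier G" for h
      by (rule Hom_zero[OF quasi_invariant_translation_Hom[OF _ b] _ that]) (use \<phi> in auto)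
    \<comment> \<open>Quasi-invariance carries the vanishing of the translation from
      \<open>b\<close> to every other point.\<close>
    moreover have "\<phi> (\<alpha> h x) - \<phi> (\<alpha> h b) = \<phi> x - \<phi> b" if "h \<in> carrier G" "x \<in> X" for h x
      using quasi_invariantD(2)[of \<phi> h x b] \<phi> that b by blast
    ultimately have "\<phi> (\<alpha> h x) = \<phi> x" if "h \<in> carrier G" "x \<in> X" for h x
      using that by (smt (verit))
    then show "\<phi> \<in> invariant" using \<phi> quasi_invariantD(1) unfolding invariant_def by blast
  next
    fix \<phi> assume "\<phi> \<in> invariant"
    then show "\<phi> \<in> {\<phi> \<in> quasi_invariant. \<forall>a\<in>?A. \<phi> a = \<phi> b}"
      using F(2) b by (auto simp: invariant_def quasi_invariant_def)
  qed
  ultimately have "\<exists>P'. lip_operator X d X d P' \<and> (\<forall>\<phi>\<in>Lip X d. P' \<phi> \<in> invariant) \<and>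
      (\<forall>\<phi>\<in>invariant. (\<phi>, P' \<phi>) \<in> lip_rel X d)"
    by (simp only:)
  then show ?thesis using that by blast
qed

end

section \<open>Lipschitz functions on the space of orbit closures\<close>

context isometric_action
begin

abbreviation orbit_closure :: "'x \<Rightarrow> 'x set" where
  "orbit_closure x \<equiv> mtopology closure_of orbit G \<alpha> x"

section \<open>The Hausdorff distance between orbit closures\<close>

text \<open>The distance of \<open>y\<close> from the orbit of \<open>x\<close>, which turns out to
  be the Hausdorff distance of the two orbit closures.\<close>

definition orbit_gap :: "'x \<Rightarrow> 'x \<Rightarrow> real" where
  "orbit_gap x y = (INF h\<in>carrier G. d (\<alpha> h x) y)"

lemma orbit_gap_le: "h \<in> carrier G \<Longrightarrow> orbit_gap x y \<le> d (\<alpha> h x) y"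
  unfolding orbit_gap_def by (intro cINF_lower bdd_belowI2[of _ 0]) auto

lemma orbit_gap_greatest: "(\<And>h. h \<in> carrier G \<Longrightarrow> c \<le> d (\<alpha> h x) y) \<Longrightarrow> c \<le> orbit_gap x y"
  unfolding orbit_gap_def by (intro cINF_greatest) auto

lemma orbit_gap_nonneg: "0 \<le> orbit_gap x y"
  by (rule orbit_gap_greatest) auto

lemma orbit_gap_le_dist: "x \<in> X \<Longrightarrow> orbit_gap x y \<le> d x y"
  using orbit_gap_le[of \<one> x y] by simp

text \<open>Applying \<open>h\<close> turns \<open>d (\<alpha> (inv h) y) x\<close> into
  \<open>d y (\<alpha> h x)\<close>, so both infima run over the same numbers.\<close>

lemma orbit_gap_commute:
  assumes "x \<in> X" "y \<in> X"
  shows "orbit_gap x y = orbit_gap y x"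
proof -
  have "orbit_gap y x \<le> orbit_gap x y" if "x \<in> X" "y \<in> X" for x y
  proof (rule orbit_gap_greatest)
    fix h assume h: "h \<in> carrier G"
    have "orbit_gap y x \<le> d (\<alpha> (inv h) y) x" using h by (intro orbit_gap_le) simp
    also have "\<dots> = d (\<alpha> h (\<alpha> (inv h) y)) (\<alpha> h x)" by (rule isometry[symmetric]) (use h that in auto)
    also have "\<dots> = d (\<alpha> h x) y" using h that by (simp add: commute)
    finally show "orbit_gap y x \<le> d (\<alpha> h x) y" .
  qed
  then show ?thesis using assms by (intro antisym)
qed

lemma in_orbit_closureD:
  assumes "z \<in> orbit_closure x" "\<epsilon> > 0"
  obtains g where "z \<in> X" "g \<in> carrier G" "d z (\<alpha> g x) < \<epsilon>"
proof -
  obtain y where "z \<in> X" "y \<in> orbit G \<alpha> x" "d z y < \<epsilon>"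
    using assms unfolding metric_closure_of by fastforce
  then show ?thesis using that unfolding orbit_def by blast
qed

lemma orbit_closure_memI:
  assumes "x \<in> X" "g \<in> carrier G"
  shows "\<alpha> g x \<in> orbit_closure x"
proof -
  have "orbit G \<alpha> x \<subseteq> topspace mtopology" using assms by (auto simp: orbit_def)
  from closure_of_subset[OF this] show ?thesis using assms unfolding orbit_def by blast
qed

text \<open>The value does not depend on which \<open>z\<close> is chosen in the closure of the
  orbit of \<open>x\<close>. Points of closures are approximated by orbit points, and isometries
  move the group elements to one side.\<close>

lemma dist_to_orbit_closure:
  assumes x: "x \<in> X" and y: "y \<in> X" and z: "z \<in> orbit_closure x"
  shows "dist_to_set d z (orbit_closure y) = orbit_gap x y"
proof (rule antisym)
  have ne: "orbit_closure y \<noteq> {}" using orbit_closure_memI[OF y one_closed] by blast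
  show "orbit_gap x y \<le> dist_to_set d z (orbit_closure y)"
    unfolding dist_to_set_def
  proof (rule cINF_greatest[OF ne])
    fix w assume w: "w \<in> orbit_closure y"
    show "orbit_gap x y \<le> d z w"
    proof (rule field_le_epsilon)
      fix e :: real assume "e > 0"
      obtain g where g: "z \<in> X" "g \<in> carrier G" "d z (\<alpha> g x) < e / 2"
        using in_orbit_closureD[OF z, of "e / 2"] \<open>e > 0\<close> by auto
      obtain h where h: "w \<in> X" "h \<in> carrier G" "d w (\<alpha> h y) < e / 2"
        using in_orbit_closureD[OF w, of "e / 2"] \<open>e > 0\<close> by auto
      \<comment> \<open>Translating by \<open>inv h\<close> brings the approximations
        \<open>g x\<close> of \<open>z\<close> and \<open>h y\<close> of \<open>w\<close> into the
        form compared in \<open>orbit_gap\<close>.\<close>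
      have "orbit_gap x y \<le> d (\<alpha> (inv h \<otimes> g) x) y" using g h by (intro orbit_gap_le) simp
      also have "\<dots> = d (\<alpha> h (\<alpha> (inv h \<otimes> g) x)) (\<alpha> h y)"
        by (rule isometry[symmetric]) (use g h x y in auto)
      also have "\<dots> = d (\<alpha> g x) (\<alpha> h y)" using g h x by (simp add: act_mult)
      also have "\<dots> \<le> d (\<alpha> g x) z + (d z w + d w (\<alpha> h y))"
        using triangle[of "\<alpha> g x" z "\<alpha> h y"] triangle[of z w "\<alpha> h y"] g h x y by fastforce
      finally show "orbit_gap x y \<le> d z w + e" using g(3) h(3) commute[of z] by simp
    qed
  qed
  show "dist_to_set d z (orbit_closure y) \<le> orbit_gap x y"
  proof (rule orbit_gap_greatest, rule field_le_epsilon)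
    fix h and e :: real assume h: "h \<in> carrier G" and "e > 0"
    obtain g where g: "z \<in> X" "g \<in> carrier G" "d z (\<alpha> g x) < e"
      using in_orbit_closureD[OF z \<open>e > 0\<close>] by auto
    \<comment> \<open>Chosen so that its distance from \<open>\<alpha> g x\<close> is exactly
      \<open>d (\<alpha> h x) y\<close>.\<close>
    let ?w = "\<alpha> g (\<alpha> (inv h) y)"
    have "?w = \<alpha> (g \<otimes> inv h) y" using g h y by (simp add: act_mult)
    then have "?w \<in> orbit_closure y" using orbit_closure_memI[OF y] g h by simp
    then have "dist_to_set d z (orbit_closure y) \<le> d z ?w"
      unfolding dist_to_set_def by (intro cINF_lower bdd_belowI2[of _ 0]) auto
    also have "\<dots> \<le> d z (\<alpha> g x) + d (\<alpha> g x) ?w" using g h x y by (intro triangle) auto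
    also have "d (\<alpha> g x) ?w = d x (\<alpha> (inv h) y)" using g h x y by (intro isometry) auto
    also have "\<dots> = d (\<alpha> h x) (\<alpha> h (\<alpha> (inv h) y))"
      by (rule isometry[symmetric]) (use h x y in auto)
    also have "\<dots> = d (\<alpha> h x) y" using h y by simp
    finally show "dist_to_set d z (orbit_closure y) \<le> d (\<alpha> h x) y + e" using g(3) by simp
  qed
qed

text \<open>Both suprema are taken over constant functions, with values \<open>orbit_gap x y\<close>
  and \<open>orbit_gap y x\<close>, and these agree.\<close>

lemma hausdorff_dist_orbit_closure:
  assumes "x \<in> X" "y \<in> X"
  shows "hausdorff_dist d (orbit_closure x) (orbit_closure y) = orbit_gap x y"
proof -
  have "(SUP z\<in>orbit_closure x. dist_to_set d z (orbit_closure y)) = orbit_gap x y"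
    if "x \<in> X" "y \<in> X" for x y
  proof -
    have "(SUP z\<in>orbit_closure x. dist_to_set d z (orbit_closure y)) = (SUP z\<in>orbit_closure x. orbit_gap x y)"
      using dist_to_orbit_closure[OF that] by (intro SUP_cong refl)
    moreover have "orbit_closure x \<noteq> {}" using orbit_closure_memI[OF that(1) one_closed] by blast
    ultimately show ?thesis by simp
  qed
  then show ?thesis using assms orbit_gap_commute[OF assms] by (simp add: hausdorff_dist_def)
qed

abbreviation quotient_space :: "'x set set" where
  "quotient_space \<equiv> orbit_closures G X d \<alpha>"

lemma quotient_space_eq: "quotient_space = orbit_closure ` X"
  by (auto simp: orbit_closures_def)

lemma hausdorff_dist_nonneg:
  "A \<in> quotient_space \<Longrightarrow> B \<in> quotient_space \<Longrightarrow> 0 \<le> hausdorff_dist d A B"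
  by (auto simp: quotient_space_eq hausdorff_dist_orbit_closure orbit_gap_nonneg)

lemma orbit_closure_act:
  assumes x: "x \<in> X" and h: "h \<in> carrier G"
  shows "orbit_closure (\<alpha> h x) = orbit_closure x"
proof -
  have "orbit G \<alpha> (\<alpha> h x) = orbit G \<alpha> x"
  proof (intro equalityI subsetI)
    fix y assume "y \<in> orbit G \<alpha> (\<alpha> h x)"
    then obtain g where "g \<in> carrier G" "y = \<alpha> (g \<otimes> h) x" using x h by (auto simp: orbit_def act_mult)
    then show "y \<in> orbit G \<alpha> x" using h by (auto simp: orbit_def)
  next
    fix y assume "y \<in> orbit G \<alpha> x"
    then obtain g where "g \<in> carrier G" "y = \<alpha> (g \<otimes> inv h) (\<alpha> h x)"
      using x h by (auto simp: orbit_def act_mult)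
    then show "y \<in> orbit G \<alpha> (\<alpha> h x)" using h unfolding orbit_def by blast
  qed
  then show ?thesis by simp
qed

section \<open>Invariant functions and functions on the quotient\<close>

text \<open>The gap is at most the distance, which gives one direction. Conversely, invariance
  allows \<open>x\<close> to be replaced by \<open>\<alpha> h x\<close> in the bound, and the
  infimum over \<open>h\<close> is the gap. Keeping the same \<open>K\<close> is what makes the
  identification isometric.\<close>

lemma Lip_quotient_bound_iff:
  assumes \<phi>: "\<And>x. x \<in> X \<Longrightarrow> f (orbit_closure x) = \<phi> x"
    and inv: "\<And>h x. h \<in> carrier G \<Longrightarrow> x \<in> X \<Longrightarrow> \<phi> (\<alpha> h x) = \<phi> x" and K: "0 \<le> K"
  shows "(\<forall>A\<in>quotient_space. \<forall>B\<in>quotient_space. \<bar>f A - f B\<bar> \<le> K * hausdorff_dist d A B) \<longleftrightarrow>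
    (\<forall>x\<in>X. \<forall>y\<in>X. \<bar>\<phi> x - \<phi> y\<bar> \<le> K * d x y)"
proof -
  have "(\<forall>A\<in>quotient_space. \<forall>B\<in>quotient_space. \<bar>f A - f B\<bar> \<le> K * hausdorff_dist d A B) \<longleftrightarrow>
      (\<forall>x\<in>X. \<forall>y\<in>X. \<bar>\<phi> x - \<phi> y\<bar> \<le> K * orbit_gap x y)"
    by (simp add: quotient_space_eq hausdorff_dist_orbit_closure \<phi>)
  also have "\<dots> \<longleftrightarrow> (\<forall>x\<in>X. \<forall>y\<in>X. \<bar>\<phi> x - \<phi> y\<bar> \<le> K * d x y)" (is "?L \<longleftrightarrow> ?R")
  proof
    assume ?L
    then show ?R using mult_left_mono[OF orbit_gap_le_dist K] by (meson order_trans)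
  next
    assume R: ?R
    show ?L
    proof (intro ballI)
      fix x y assume xy: "x \<in> X" "y \<in> X"
      have *: "\<bar>\<phi> x - \<phi> y\<bar> \<le> K * d (\<alpha> h x) y" if "h \<in> carrier G" for h
        using R xy inv[OF that xy(1)] act_closed[OF that xy(1)] by metis
      show "\<bar>\<phi> x - \<phi> y\<bar> \<le> K * orbit_gap x y"
      \<comment> \<open>The infimum is reached after dividing by \<open>K\<close>, so
        \<open>K = 0\<close> is separate.\<close>
      proof (cases "K = 0")
        case True
        then show ?thesis using *[OF one_closed] by simp
      next
        case False
        then have "\<bar>\<phi> x - \<phi> y\<bar> / K \<le> orbit_gap x y"
          using * K by (intro orbit_gap_greatest) (simp add: divide_le_eq mult.commute)
        then show ?thesis using False K by (simp add: divide_le_eq mult.commute)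
      qed
    qed
  qed
  finally show ?thesis .
qed

lemma pullback_invariant:
  assumes f: "f \<in> Lip quotient_space (hausdorff_dist d)"
  shows "(\<lambda>x. f (orbit_closure x)) \<in> invariant"
    and "lip_const X d (\<lambda>x. f (orbit_closure x)) = lip_const quotient_space (hausdorff_dist d) f"
proof -
  let ?\<phi> = "\<lambda>x. f (orbit_closure x)"
  let ?L = "lip_const quotient_space (hausdorff_dist d) f"
  have bound_iff: "(\<forall>A\<in>quotient_space. \<forall>B\<in>quotient_space. \<bar>f A - f B\<bar> \<le> K * hausdorff_dist d A B) \<longleftrightarrow>
    (\<forall>x\<in>X. \<forall>y\<in>X. \<bar>?\<phi> x - ?\<phi> y\<bar> \<le> K * d x y)" if "0 \<le> K" for K
    by (rule Lip_quotient_bound_iff) (simp_all add: orbit_closure_act that)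
  have L: "0 \<le> ?L" by (rule lip_const_nonneg[OF hausdorff_dist_nonneg f])
  have "\<forall>A\<in>quotient_space. \<forall>B\<in>quotient_space. \<bar>f A - f B\<bar> \<le> ?L * hausdorff_dist d A B"
    using lip_const_bound[OF hausdorff_dist_nonneg f] by blast
  then have \<phi>: "?\<phi> \<in> Lip X d" unfolding bound_iff[OF L] by (intro LipI[of X ?\<phi> ?L]) auto
  then show "?\<phi> \<in> invariant" by (simp add: invariant_def orbit_closure_act)
  \<comment> \<open>Two nonnegative numbers with the same nonnegative upper bounds are
    equal.\<close>
  have "lip_const X d ?\<phi> \<le> K \<longleftrightarrow> ?L \<le> K" if "0 \<le> K" for K
    by (simp only: lip_const_le_iff[OF nonneg \<phi> that] bound_iff[OF that]
        lip_const_le_iff[OF hausdorff_dist_nonneg f that])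
  then show "lip_const X d ?\<phi> = ?L"
    using L lip_const_nonneg[OF nonneg \<phi>] by (metis order_antisym order_refl)
qed

text \<open>If two orbit closures coincide, their gap is 0, so some \<open>\<alpha> h x\<close> lies
  arbitrarily close to \<open>y\<close>. Since \<open>\<phi> (\<alpha> h x) = \<phi> x\<close>,
  continuity gives \<open>\<phi> x = \<phi> y\<close>, and a chosen representative of each closure
  defines \<open>f\<close>.\<close>

lemma invariant_factors:
  assumes \<phi>: "\<phi> \<in> invariant"
  obtains f where "f \<in> Lip quotient_space (hausdorff_dist d)" "\<And>x. x \<in> X \<Longrightarrow> f (orbit_closure x) = \<phi> x"
proof -
  have Lip: "\<phi> \<in> Lip X d" and inv: "\<And>h x. h \<in> carrier G \<Longrightarrow> x \<in> X \<Longrightarrow> \<phi> (\<alpha> h x) = \<phi> x"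
    using \<phi> by (auto simp: invariant_def)
  let ?L = "lip_const X d \<phi>"
  have L: "0 \<le> ?L" by (rule lip_const_nonneg[OF nonneg Lip])
  have eq: "\<phi> x = \<phi> y" if xy: "x \<in> X" "y \<in> X" "orbit_closure x = orbit_closure y" for x y
  proof -
    have "orbit_gap x y = orbit_gap x x"
      using hausdorff_dist_orbit_closure[of x x] hausdorff_dist_orbit_closure[of x y] xy by simp
    then have "orbit_gap x y \<le> 0" using orbit_gap_le_dist[OF xy(1), of x] xy(1) by simp
    have "\<bar>\<phi> x - \<phi> y\<bar> \<le> 0"
    proof (rule field_le_epsilon)
      fix e :: real assume e: "e > 0"
      obtain \<delta> where \<delta>: "\<delta> > 0" "\<And>x y. x \<in> X \<Longrightarrow> y \<in> X \<Longrightarrow> d x y < \<delta> \<Longrightarrow> \<bar>\<phi> x - \<phi> y\<bar> < e"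
        using Lip_small[OF Lip e] by blast
      obtain h where "h \<in> carrier G" "d (\<alpha> h x) y < \<delta>"
        using orbit_gap_greatest[of \<delta> x y] \<open>orbit_gap x y \<le> 0\<close> \<delta>(1) by force
      then show "\<bar>\<phi> x - \<phi> y\<bar> \<le> 0 + e" using \<delta>(2)[of "\<alpha> h x" y] inv xy by simp
    qed
    then show ?thesis by simp
  qed
  define f where "f A = \<phi> (SOME x. x \<in> X \<and> orbit_closure x = A)" for A
  have f: "f (orbit_closure x) = \<phi> x" if "x \<in> X" for x
  proof -
    have "\<exists>y. y \<in> X \<and> orbit_closure y = orbit_closure x" using that by blast
    from someI_ex[OF this] show ?thesis unfolding f_def using eq that by blast
  qed
  have "\<forall>A\<in>quotient_space. \<forall>B\<in>quotient_space. \<bar>f A - f B\<bar> \<le> ?L * hausdorff_dist d A B"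
    using Lip_bound[OF Lip] by (subst Lip_quotient_bound_iff[of f \<phi>, OF f inv L]) auto
  then have "f \<in> Lip quotient_space (hausdorff_dist d)" by (intro LipI[where K = ?L]) auto
  then show ?thesis using f that by blast
qed

section \<open>The subspace of classes of invariant functions\<close>

lemma invariant_Lip: "\<phi> \<in> invariant \<Longrightarrow> \<phi> \<in> Lip X d"
  by (simp add: invariant_def)

lemma closed_subspace_invariant: "nv_closed_subspace (LIP X d) (lip_class X d ` invariant)"
  unfolding nv_closed_subspace_def
proof (intro conjI ballI allI impI)
  show "lip_class X d ` invariant \<subseteq> nv_carrier (LIP X d)"
    by (auto simp: LIP_carrier invariant_def)
  have "(\<lambda>x. 0) \<in> invariant" by (auto simp: invariant_def intro!: LipI[where K = 0])
  then show "lip_class X d ` invariant \<noteq> {}" by blast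
next
  fix u v assume "u \<in> lip_class X d ` invariant" "v \<in> lip_class X d ` invariant"
  then obtain \<phi> \<psi> where *: "\<phi> \<in> invariant" "\<psi> \<in> invariant" "u = lip_class X d \<phi>" "v = lip_class X d \<psi>"
    by blast
  moreover have "(\<lambda>x. \<phi> x + \<psi> x) \<in> invariant" using * by (auto simp: invariant_def intro: Lip_add)
  ultimately show "nv_add (LIP X d) u v \<in> lip_class X d ` invariant"
    by (simp add: LIP_add_class invariant_Lip)
next
  fix c v assume "v \<in> lip_class X d ` invariant"
  then obtain \<phi> where *: "\<phi> \<in> invariant" "v = lip_class X d \<phi>" by blast
  moreover have "(\<lambda>x. c * \<phi> x) \<in> invariant" using * by (auto simp: invariant_def intro: Lip_scale)
  ultimately show "nv_scale (LIP X d) c v \<in> lip_class X d ` invariant"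
    by (simp add: LIP_scale_class invariant_Lip)
next
  fix s :: "nat \<Rightarrow> ('x \<Rightarrow> real) set" and v
  assume s: "\<forall>n. s n \<in> lip_class X d ` invariant" and v: "v \<in> nv_carrier (LIP X d)"
    and lim: "(\<lambda>n. nv_norm (LIP X d) (nv_add (LIP X d) (s n) (nv_scale (LIP X d) (-1) v))) \<longlonglongrightarrow> 0"
  obtain \<psi> where \<psi>: "\<And>n. \<psi> n \<in> invariant" "\<And>n. s n = lip_class X d (\<psi> n)"
    using s unfolding image_iff by metis
  obtain \<phi> where \<phi>: "\<phi> \<in> Lip X d" "v = lip_class X d \<phi>" using v unfolding LIP_carrier by blast
  let ?u = "\<lambda>n x. \<psi> n x + (-1) * \<phi> x"
  have u: "?u n \<in> Lip X d" for n by (intro Lip_add Lip_scale \<phi>(1) invariant_Lip \<psi>(1))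
  have "nv_norm (LIP X d) (nv_add (LIP X d) (s n) (nv_scale (LIP X d) (-1) v)) = lip_const X d (?u n)" for n
    by (simp only: \<psi>(2) \<phi>(2) LIP_scale_class[OF \<phi>(1)] LIP_norm_class[OF u]
        LIP_add_class[OF invariant_Lip[OF \<psi>(1)] Lip_scale[OF \<phi>(1)]])
  then have lim': "(\<lambda>n. lip_const X d (?u n)) \<longlonglongrightarrow> 0" using lim by presburger
  have "\<phi> (\<alpha> h x) = \<phi> x" if h: "h \<in> carrier G" and x: "x \<in> X" for h x
  proof -
    \<comment> \<open>Since \<open>\<psi> n\<close> is invariant, the change of
      \<open>\<phi>\<close> from \<open>x\<close> to \<open>\<alpha> h x\<close> is, up to sign,
      that of the difference \<open>?u n\<close>, whose Lipschitz constant tends to 0.\<close>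
    have "\<bar>\<phi> (\<alpha> h x) - \<phi> x\<bar> \<le> lip_const X d (?u n) * d (\<alpha> h x) x" for n
      using Lip_bound[OF u[of n], of "\<alpha> h x" x] \<psi>(1)[of n] h x by (simp add: invariant_def abs_minus_commute)
    moreover have "(\<lambda>n. lip_const X d (?u n) * d (\<alpha> h x) x) \<longlonglongrightarrow> 0"
      using tendsto_mult_right[OF lim', of "d (\<alpha> h x) x"] by simp
    ultimately have "\<bar>\<phi> (\<alpha> h x) - \<phi> x\<bar> \<le> 0" by (intro LIMSEQ_le_const) auto
    then show ?thesis by simp
  qed
  then show "v \<in> lip_class X d ` invariant" using \<phi> by (auto simp: invariant_def)
qed

text \<open>The projection on representatives is lifted to classes. The lift maps into the subspace
  and fixes it pointwise, so it is idempotent with exactly this range.\<close>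

lemma complemented_subspace_invariant:
  assumes "amenable G T" "finite_dimensional_Hom_real G T"
  shows "nv_complemented_subspace (LIP X d) (lip_class X d ` invariant)"
proof -
  obtain P where P: "lip_operator X d X d P"
    "\<And>\<phi>. \<phi> \<in> Lip X d \<Longrightarrow> P \<phi> \<in> invariant"
    "\<And>\<phi>. \<phi> \<in> invariant \<Longrightarrow> (\<phi>, P \<phi>) \<in> lip_rel X d"
    using invariant_projection[OF assms] by blast
  obtain F where F: "nv_bounded_linear (LIP X d) (LIP X d) F"
    "\<And>\<phi>. \<phi> \<in> Lip X d \<Longrightarrow> F (lip_class X d \<phi>) = lip_class X d (P \<phi>)"
    using lip_operator_lift[OF P(1) nonneg nonneg] by blast
  have fixed: "F (lip_class X d \<phi>) = lip_class X d \<phi>" if "\<phi> \<in> invariant" for \<phi>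
    using F(2)[OF invariant_Lip[OF that]] equiv_class_eq[OF equiv_lip_rel P(3)[OF that]] by simp
  have "F ` nv_carrier (LIP X d) = lip_class X d ` invariant"
  proof (intro equalityI subsetI)
    fix v assume "v \<in> F ` nv_carrier (LIP X d)"
    then obtain \<phi> where "\<phi> \<in> Lip X d" "v = F (lip_class X d \<phi>)" unfolding LIP_carrier by blast
    then show "v \<in> lip_class X d ` invariant" using F(2) P(2) by simp
  next
    fix v assume "v \<in> lip_class X d ` invariant"
    then obtain \<phi> where \<phi>: "\<phi> \<in> invariant" "v = lip_class X d \<phi>" by blast
    then have "v = F v" "v \<in> nv_carrier (LIP X d)"
      using fixed invariant_Lip unfolding LIP_carrier by simp_all
    then show "v \<in> F ` nv_carrier (LIP X d)" by (rule image_eqI)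
  qed
  moreover from this have "F (F v) = F v" if "v \<in> nv_carrier (LIP X d)" for v
    using fixed that by (metis (no_types, lifting) image_eqI image_iff)
  ultimately show ?thesis
    unfolding nv_complemented_subspace_def using closed_subspace_invariant F(1) by blast
qed

text \<open>The isometry is composition with \<open>orbit_closure\<close>. Replacing only the
  carrier of \<open>LIP X d\<close> lets the subspace inherit operations and norm.\<close>

lemma quotient_isometric_invariant:
  "nv_isometrically_isomorphic (LIP quotient_space (hausdorff_dist d))
    ((LIP X d)\<lparr>nv_carrier := lip_class X d ` invariant\<rparr>)"
proof -
  let ?Q = "LIP quotient_space (hausdorff_dist d)" and ?q = "lip_class quotient_space (hausdorff_dist d)"
  let ?S = "\<lambda>f x. f (orbit_closure x)"
  have "\<bar>?S f x - ?S f y\<bar> \<le> 1 * lip_const quotient_space (hausdorff_dist d) f * d x y"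
    if "f \<in> Lip quotient_space (hausdorff_dist d)" "x \<in> X" "y \<in> X" for f x y
    using Lip_bound[OF invariant_Lip[OF pullback_invariant(1)[OF that(1)]] that(2,3)] that
    by (simp add: pullback_invariant(2))
  then have S: "lip_operator quotient_space (hausdorff_dist d) X d ?S"
    unfolding lip_operator_def by (intro conjI exI[of _ 1]) auto
  then obtain F where F: "nv_bounded_linear ?Q (LIP X d) F"
    "\<And>f. f \<in> Lip quotient_space (hausdorff_dist d) \<Longrightarrow> F (?q f) = lip_class X d (?S f)"
    using lip_operator_lift[OF S hausdorff_dist_nonneg nonneg] by blast
  have image: "F ` nv_carrier ?Q = lip_class X d ` invariant"
  proof (intro equalityI subsetI)
    fix v assume "v \<in> F ` nv_carrier ?Q"
    then obtain f where "f \<in> Lip quotient_space (hausdorff_dist d)" "v = F (?q f)"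
      unfolding LIP_carrier by blast
    then show "v \<in> lip_class X d ` invariant" using F(2) pullback_invariant(1) by simp
  next
    fix v assume "v \<in> lip_class X d ` invariant"
    then obtain \<phi> where \<phi>: "\<phi> \<in> invariant" "v = lip_class X d \<phi>" by blast
    obtain f where f: "f \<in> Lip quotient_space (hausdorff_dist d)"
      "\<And>x. x \<in> X \<Longrightarrow> f (orbit_closure x) = \<phi> x"
      using invariant_factors[OF \<phi>(1)] by blast
    have "(\<phi>, ?S f) \<in> lip_rel X d"
      by (rule lip_relI[where c = 0]) (use \<phi>(1) f pullback_invariant(1) invariant_Lip in auto)
    then have "v = F (?q f)" using F(2)[OF f(1)] \<phi>(2) equiv_class_eq[OF equiv_lip_rel] by simp
    then show "v \<in> F ` nv_carrier ?Q" using f(1) unfolding LIP_carrier by blast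
  qed
  have "inj_on F (nv_carrier ?Q)"
  proof (rule inj_onI)
    fix u v assume "u \<in> nv_carrier ?Q" "v \<in> nv_carrier ?Q" and eq: "F u = F v"
    then obtain f g where f: "f \<in> Lip quotient_space (hausdorff_dist d)" "u = ?q f"
      and g: "g \<in> Lip quotient_space (hausdorff_dist d)" "v = ?q g"
      unfolding LIP_carrier by blast
    have "(?S f, ?S g) \<in> lip_rel X d"
      using eq F(2)[OF f(1)] F(2)[OF g(1)] f g pullback_invariant(1) invariant_Lip
      by (simp add: lip_class_eq_iff)
    \<comment> \<open>Every point of the quotient is some \<open>orbit_closure x\<close>, so a
      difference that is constant after pullback was constant before.\<close>
    then have "(f, g) \<in> lip_rel quotient_space (hausdorff_dist d)"
      using f(1) g(1) by (auto simp: lip_rel_def quotient_space_eq)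
    then show "u = v" using f g by (simp add: lip_class_eq_iff)
  qed
  moreover have "nv_norm (LIP X d) (F v) = nv_norm ?Q v" if v: "v \<in> nv_carrier ?Q" for v
  proof -
    obtain f where f: "f \<in> Lip quotient_space (hausdorff_dist d)" "v = ?q f"
      using v unfolding LIP_carrier by blast
    then show ?thesis
      using F(2)[OF f(1)] LIP_norm_class[OF f(1)] LIP_norm_class[OF invariant_Lip[OF pullback_invariant(1)[OF f(1)]]]
      by (simp add: pullback_invariant(2))
  qed
  moreover have "nv_linear ?Q ((LIP X d)\<lparr>nv_carrier := lip_class X d ` invariant\<rparr>) F"
    using F(1) image unfolding nv_bounded_linear_def nv_linear_def by auto
  ultimately show ?thesis
    unfolding nv_isometrically_isomorphic_def bij_betw_def using image by auto
qed

end

theorem corollary1p5: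
  fixes G :: "('g, 'm) monoid_scheme" and T :: "'g topology"
    and X :: "'x set" and d :: "'x \<Rightarrow> 'x \<Rightarrow> real" and \<alpha> :: "'g \<Rightarrow> 'x \<Rightarrow> 'x"
  assumes "topological_group G T"
    and "amenable G T"
    and "Metric_space X d"
    and "continuous_isometric_action G T X d \<alpha>"
    and "finite_dimensional_Hom_real G T"
  shows "\<exists>Y. nv_complemented_subspace (LIP X d) Y \<and>
    nv_isometrically_isomorphic (LIP (orbit_closures G X d \<alpha>) (hausdorff_dist d))
      ((LIP X d)\<lparr>nv_carrier := Y\<rparr>)"
proof -
  interpret isometric_action X d G T \<alpha>
    by (simp add: isometric_action_def isometric_action_axioms_def assms)
  \<comment> \<open>The witness for \<open>Y\<close> is the set of classes of the functions in
    \<open>invariant\<close>.\<close>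
  show ?thesis
    using complemented_subspace_invariant[OF assms(2,5)] quotient_isometric_invariant by blast
qed

end
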